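(* Let $I=\mathbb R/l\mathbb Z$ for some $l>0$ or $I=\mathbb R$, let $\gamma:I\to\mathbb R^n$ be a smooth embedded curve parameterized by arc length, and let $\Gamma=\gamma(I)$. Then $\gamma$ satisfies $\mathcal H\gamma\equiv0$ if and only if $$\lim_{\varepsilon\downarrow0}\int_{\Gamma\setminus B_\varepsilon(x)}\frac{\kappa_\gamma(x,y)-\kappa_\gamma(x)}{|x-y|^2}\,d\mathscr H^1(y)=0$$ for all points $x$ of the curve.
   Context: In the displayed integral, points of $I$ are identified with their images on $\Gamma$, so $x,y$ are points of $\Gamma\subset\mathbb R^n$, $|x-y|$ is their Euclidean distance, $B_\varepsilon(x)$ is the Euclidean ball, and $\mathscr H^1$ is one-dimensional Hausdorff measure. $\kappa_\gamma(x)=\gamma''(x)$ is the curvature vector. For distinct points $x,y$ of the curve there is either a unique circle or a straight line through these two points that is tangent to the curve at $x$; $\kappa_\gamma(x,y)$ denotes the curvature vector of this circle at $x$, and $\kappa_\gamma(x,y)=0$ if the tangent at $x$ points in the direction of $y$. For an arc-length parameterized curve, $$\mathcal H\gamma(x)=2\lim_{\epsilon\downarrow0}\int_{\{w\in J:\,|w|\ge\epsilon\}}\Big(2\frac{P^\bot_{\gamma'(x)}(\gamma(x+w)-\gamma(x))}{|\gamma(x+w)-\gamma(x)|^2}-\gamma''(x)\Big)\frac{dw}{|\gamma(x+w)-\gamma(x)|^2},$$ where $J=[-\frac l2,\frac l2]$ if $I=\mathbb R/l\mathbb Z$ and $J=\mathbb R$ if $I=\mathbb R$, and $P^\bot_{\gamma'(x)}$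 is the orthogonal projection onto the orthogonal complement of $\gamma'(x)$. *)

theory Defs
  imports "HOL-Analysis.Analysis"
begin

text \<open>A curve with parameter domain \<open>\<real>/l\<int>\<close> is represented by its \<open>l\<close>-periodic lift to \<open>\<real>\<close>.\<close>

datatype curve_domain = Real_Line | Real_Mod real

fun same_param :: "curve_domain \<Rightarrow> real \<Rightarrow> real \<Rightarrow> bool" where
  "same_param Real_Line s t \<longleftrightarrow> s = t"
| "same_param (Real_Mod l) s t \<longleftrightarrow> (\<exists>k::int. s - t = of_int k * l)"

fun offset_range :: "curve_domain \<Rightarrow> real set" where
  "offset_range Real_Line = UNIV"
| "offset_range (Real_Mod l) = {- l / 2 .. l / 2}"

definition vderiv :: "(real \<Rightarrow> 'a::real_normed_vector) \<Rightarrow> real \<Rightarrow> 'a" where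
  "vderiv f = (\<lambda>t. vector_derivative f (at t))"

definition smooth :: "(real \<Rightarrow> 'a::real_normed_vector) \<Rightarrow> bool" where
  "smooth f \<longleftrightarrow> (\<forall>k t. (vderiv ^^ k) f differentiable (at t))"

text \<open>
  The condition \<open>\<gamma> s = \<gamma> t \<longleftrightarrow> same_param I s t\<close> says that \<open>\<gamma>\<close> descends to a well-defined
  injective map on the domain. Since \<open>\<real> \<rightarrow> \<real>/l\<int>\<close> is an open quotient map, the descended
  map is a homeomorphism onto its image iff moreover \<open>\<gamma>\<close> is continuous (here: smooth) and open
  onto its image.
\<close>

definition smooth_embedded_curve :: "curve_domain \<Rightarrow> (real \<Rightarrow> 'a::real_normed_vector) \<Rightarrow> bool" where
  "smooth_embedded_curve I \<gamma> \<longleftrightarrow>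
     smooth \<gamma> \<and>
     (\<forall>t. vderiv \<gamma> t \<noteq> 0) \<and>
     (\<forall>s t. \<gamma> s = \<gamma> t \<longleftrightarrow> same_param I s t) \<and>
     open_map euclidean (top_of_set (range \<gamma>)) \<gamma>"

definition arc_length_param :: "(real \<Rightarrow> 'a::real_normed_vector) \<Rightarrow> bool" where
  "arc_length_param \<gamma> \<longleftrightarrow> (\<forall>t. norm (vderiv \<gamma> t) = 1)"

text \<open>The curvature vector of a curve that is parameterized by arc length.\<close>

definition curvature_vector :: "(real \<Rightarrow> 'a::real_normed_vector) \<Rightarrow> real \<Rightarrow> 'a" where
  "curvature_vector \<gamma> s = vderiv (vderiv \<gamma>) s"

definition arc_length_circle :: "(real \<Rightarrow> 'a::real_inner) \<Rightarrow> bool" where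
  "arc_length_circle \<sigma> \<longleftrightarrow>
     (\<exists>c r u v. 0 < r \<and> norm u = 1 \<and> norm v = 1 \<and> u \<bullet> v = 0 \<and>
        \<sigma> = (\<lambda>s. c + r *\<^sub>R (cos (s / r) *\<^sub>R u + sin (s / r) *\<^sub>R v)))"

text \<open>
  For an arc-length parameterized \<open>\<gamma>\<close>, a circle is tangent to \<open>\<gamma>\<close> at \<open>\<gamma> s\<close> iff it has an
  arc-length parameterization that starts at \<open>\<gamma> s\<close> with velocity \<open>\<gamma>' s\<close> (reverse and shift its
  parameter).
\<close>

definition tangent_circle :: "(real \<Rightarrow> 'a::real_inner) \<Rightarrow> real \<Rightarrow> (real \<Rightarrow> 'a) \<Rightarrow> bool" where
  "tangent_circle \<gamma> s \<sigma> \<longleftrightarrow>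
     arc_length_circle \<sigma> \<and> \<sigma> 0 = \<gamma> s \<and> vderiv \<sigma> 0 = vderiv \<gamma> s"

text \<open>
  \<open>\<kappa>\<^sub>\<gamma>(x, y)\<close> for \<open>x = \<gamma> s\<close>. The first case, in which \<open>y\<close> lies on the tangent line at \<open>x\<close>,
  also gives the (irrelevant) value for \<open>y = x\<close>.
\<close>

definition circle_curvature :: "(real \<Rightarrow> 'a::real_inner) \<Rightarrow> real \<Rightarrow> 'a \<Rightarrow> 'a" where
  "circle_curvature \<gamma> s y =
     (if \<exists>a. y = \<gamma> s + a *\<^sub>R vderiv \<gamma> s then 0
      else THE k. \<exists>\<sigma>. tangent_circle \<gamma> s \<sigma> \<and> y \<in> range \<sigma> \<and> k = curvature_vector \<sigma> 0)"

definition hausdorff1_pre :: "real \<Rightarrow> 'a::metric_space set \<Rightarrow> ennreal" where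
  "hausdorff1_pre \<delta> A =
     (INF C \<in> {C :: nat \<Rightarrow> 'a set. A \<subseteq> (\<Union>i. C i) \<and> (\<forall>i. bounded (C i) \<and> diameter (C i) \<le> \<delta>)}.
        \<Sum>i. ennreal (diameter (C i)))"

definition hausdorff1_outer :: "'a::metric_space set \<Rightarrow> ennreal" where
  "hausdorff1_outer A = (SUP \<delta>\<in>{0<..}. hausdorff1_pre \<delta> A)"

text \<open>
  As a metric outer measure, \<open>hausdorff1_outer\<close> is countably additive on Borel sets, so
  that \<open>measure_of\<close> does not fall back to the zero measure.
\<close>

definition hausdorff1 :: "'a::metric_space measure" where
  "hausdorff1 = measure_of UNIV (sets borel) hausdorff1_outer"

text \<open>The orthogonal projection onto the orthogonal complement of the vector \<open>\<tau>\<close>.\<close>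

definition perp_proj :: "'a::real_inner \<Rightarrow> 'a \<Rightarrow> 'a" where
  "perp_proj \<tau> v = v - ((v \<bullet> \<tau>) / (\<tau> \<bullet> \<tau>)) *\<^sub>R \<tau>"

definition H_integrand :: "(real \<Rightarrow> 'a::real_inner) \<Rightarrow> real \<Rightarrow> real \<Rightarrow> 'a" where
  "H_integrand \<gamma> x w =
     (1 / (norm (\<gamma> (x + w) - \<gamma> x))\<^sup>2) *\<^sub>R
       ((2 / (norm (\<gamma> (x + w) - \<gamma> x))\<^sup>2) *\<^sub>R perp_proj (vderiv \<gamma> x) (\<gamma> (x + w) - \<gamma> x)
         - vderiv (vderiv \<gamma>) x)"

text \<open>
  \<open>has_H I \<gamma> x v\<close> means that the principal value defining \<open>\<H>\<gamma>(x)\<close> exists and equals \<open>v\<close>.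
  Integrability is required explicitly because the library integral of a non-integrable function
  is \<open>0\<close>; it suffices to have it for small \<open>\<epsilon>\<close>, as the domains decrease in \<open>\<epsilon>\<close>.
\<close>

definition has_H ::
  "curve_domain \<Rightarrow> (real \<Rightarrow> 'a::{real_inner, banach, second_countable_topology}) \<Rightarrow> real \<Rightarrow> 'a \<Rightarrow> bool"
where
  "has_H I \<gamma> x v \<longleftrightarrow>
     (\<forall>\<epsilon>>0. set_integrable lborel {w \<in> offset_range I. \<epsilon> \<le> \<bar>w\<bar>} (H_integrand \<gamma> x)) \<and>
     ((\<lambda>\<epsilon>. 2 *\<^sub>R (LINT w:{w \<in> offset_range I. \<epsilon> \<le> \<bar>w\<bar>}|lborel. H_integrand \<gamma> x w)) \<longlongrightarrow> v)
       (at_right 0)"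

end

theory Submission
  imports Defs
begin

text \<open>
  Both sides are principal values of one and the same integral; only the cutoff around the
  base point differs.

  Fix \<open>x\<close> and put \<open>c w = \<gamma> (x + w)\<close>. Elementary geometry shows
  \<open>\<kappa>\<^sub>\<gamma>(x, y) = 2 P\<^sup>\<bottom>(y - x) / |y - x|\<^sup>2\<close> (\<open>circle_curvature_eq\<close>), so
  at \<open>y = c w\<close> the geometric integrand is exactly \<open>H_integrand \<gamma> x w\<close>. Since \<open>c\<close> is injective
  with unit speed on the interior of the offset range, Hausdorff measure on its image is the
  push-forward of Lebesgue measure (\<open>hausdorff1_image_transfer\<close>); at most one curve point is
  missed, and points are null sets. The integral over
  \<open>\<Gamma> - B\<^sub>\<epsilon>(x)\<close> is therefore the Lebesgue integral of \<open>H_integrand\<close> over the offsets with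
  \<open>\<epsilon> \<le> |c w - c 0|\<close>, whereas \<open>has_H\<close> integrates over those with \<open>\<epsilon> \<le> |w|\<close>.

  The two families of domains are cofinal, because an embedded curve returns close to \<open>\<gamma> x\<close>
  only for offsets close to \<open>0\<close> (\<open>embedded_curve_separation\<close>); so integrability for all \<open>\<epsilon>\<close>
  means the same for both. The values agree in the limit: by Taylor expansion a chord satisfies
  \<open>|w| - K w\<^sup>2 \<le> |c w - c 0| \<le> |w|\<close>, so the domains for one \<open>\<epsilon>\<close> differ by a set of measure
  \<open>O(\<epsilon>\<^sup>2)\<close>, on which the integrand is \<open>O(1/\<epsilon>)\<close> because the curvature term removes its leading
  singularity (\<open>chord_and_H_integrand_bounds\<close>, \<open>principal_value_cutoffs\<close>).

  The measure-theoretic half starts from the bare definition of \<open>hausdorff1\<close>. Caratheodory's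
  criterion for metric outer measures identifies it with \<open>hausdorff1_outer\<close> on Borel sets
  (\<open>emeasure_hausdorff1\<close>), and an arc of a unit-speed curve has measure equal to its parameter
  length: at most, by covering it with short arcs, and at least, by projecting short arcs to
  their tangents (\<open>hausdorff1_outer_image_interval\<close>).
\<close>

section \<open>One-dimensional Hausdorff measure on Borel sets\<close>

lemma hausdorff1_pre_le:
  assumes "A \<subseteq> (\<Union>i. C i)" "\<And>i. bounded (C i)" "\<And>i. diameter (C i) \<le> \<delta>"
  shows "hausdorff1_pre \<delta> A \<le> (\<Sum>i. ennreal (diameter (C i)))"
  unfolding hausdorff1_pre_def using assms by (intro INF_lower) auto

lemma hausdorff1_pre_antimono:
  assumes "\<delta> \<le> \<delta>'"
  shows "hausdorff1_pre \<delta>' A \<le> hausdorff1_pre \<delta> A"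
  unfolding hausdorff1_pre_def using assms by (intro INF_superset_mono) (auto intro: order_trans)

lemma hausdorff1_pre_mono:
  assumes "A \<subseteq> B"
  shows "hausdorff1_pre \<delta> A \<le> hausdorff1_pre \<delta> B"
  unfolding hausdorff1_pre_def using assms by (intro INF_superset_mono) auto

lemma hausdorff1_pre_countable_subadditive:
  "hausdorff1_pre \<delta> (\<Union>i. A i) \<le> (\<Sum>i. hausdorff1_pre \<delta> (A i))"
proof (cases "(\<Sum>i. hausdorff1_pre \<delta> (A i)) < \<infinity>")
  case fin: True
  have fin_i: "hausdorff1_pre \<delta> (A i) < \<infinity>" for i
    using ennreal_suminf_lessD[of "\<lambda>i. hausdorff1_pre \<delta> (A i)" \<infinity> i] fin by auto
  show ?thesis
  proof (rule ennreal_le_epsilon)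
    fix e :: real assume "e > 0"
    define \<eta> where "\<eta> i = e * (1/2) ^ Suc i" for i
    have \<eta>: "\<eta> i > 0" for i using \<open>e > 0\<close> by (simp add: \<eta>_def)
    have "\<exists>C. A i \<subseteq> (\<Union>j. C j) \<and> (\<forall>j. bounded (C j) \<and> diameter (C j) \<le> \<delta>) \<and>
        (\<Sum>j. ennreal (diameter (C j))) \<le> hausdorff1_pre \<delta> (A i) + ennreal (\<eta> i)" for i
    proof -
      have "hausdorff1_pre \<delta> (A i) < hausdorff1_pre \<delta> (A i) + ennreal (\<eta> i)"
        using fin_i[of i] \<eta>[of i]
          ennreal_add_left_cancel_less[of "hausdorff1_pre \<delta> (A i)" 0 "ennreal (\<eta> i)"] by auto
      then show ?thesis
        unfolding hausdorff1_pre_def INF_less_iff by (auto intro: less_imp_le)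
    qed
    then obtain C :: "nat \<Rightarrow> nat \<Rightarrow> 'a set" where C: "\<And>i. A i \<subseteq> (\<Union>j. C i j)"
        "\<And>i j. bounded (C i j)" "\<And>i j. diameter (C i j) \<le> \<delta>"
        "\<And>i. (\<Sum>j. ennreal (diameter (C i j))) \<le> hausdorff1_pre \<delta> (A i) + ennreal (\<eta> i)"
      by metis
    define E where "E = (\<lambda>k. case prod_decode k of (i, j) \<Rightarrow> C i j)"
    have "(\<Union>i. A i) \<subseteq> (\<Union>k. E k)"
    proof
      fix x assume "x \<in> (\<Union>i. A i)"
      then obtain i j where "x \<in> C i j" using C(1) by blast
      then have "x \<in> E (prod_encode (i, j))" by (simp add: E_def)
      then show "x \<in> (\<Union>k. E k)" by blast
    qed
    then have "hausdorff1_pre \<delta> (\<Union>i. A i) \<le> (\<Sum>k. ennreal (diameter (E k)))"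
      by (rule hausdorff1_pre_le) (auto simp: E_def C(2,3) split: prod.split)
    also have "\<dots> = (\<Sum>i. \<Sum>j. ennreal (diameter (C i j)))"
      unfolding E_def
      by (subst suminf_ennreal_2dimen[symmetric, where f="\<lambda>(i,j). ennreal (diameter (C i j))"])
         (auto intro!: suminf_cong split: prod.split)
    also have "\<dots> \<le> (\<Sum>i. hausdorff1_pre \<delta> (A i) + ennreal (\<eta> i))"
      by (intro suminf_le C(4)) auto
    also have "\<dots> = (\<Sum>i. hausdorff1_pre \<delta> (A i)) + (\<Sum>i. ennreal (\<eta> i))"
      by (simp add: suminf_add)
    also have "(\<Sum>i. ennreal (\<eta> i)) = ennreal e"
    proof -
      have "\<eta> sums (e * 1)" unfolding \<eta>_def by (intro sums_mult power_half_series)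
      then show ?thesis using \<eta> \<open>e > 0\<close>
        by (intro suminf_ennreal_eq) (auto simp: less_imp_le)
    qed
    finally show "hausdorff1_pre \<delta> (\<Union>i. A i) \<le> (\<Sum>i. hausdorff1_pre \<delta> (A i)) + ennreal e" .
  qed
qed (auto simp: not_less top.extremum_unique)

lemma hausdorff1_pre_le_outer:
  "\<delta> > 0 \<Longrightarrow> hausdorff1_pre \<delta> A \<le> hausdorff1_outer A"
  unfolding hausdorff1_outer_def by (intro SUP_upper) auto

lemma hausdorff1_outer_mono:
  "A \<subseteq> B \<Longrightarrow> hausdorff1_outer A \<le> hausdorff1_outer B"
  unfolding hausdorff1_outer_def by (intro SUP_mono') (auto intro: hausdorff1_pre_mono)

lemma hausdorff1_outer_singleton: "hausdorff1_outer {p} = 0"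
proof -
  have "hausdorff1_pre \<delta> {p} \<le> (\<Sum>i::nat. ennreal (diameter {p}))" if "\<delta> > 0" for \<delta>
    by (rule hausdorff1_pre_le) (use that in auto)
  then show ?thesis
    unfolding hausdorff1_outer_def by (simp add: SUP_eq_const bot_ennreal_def[symmetric])
qed

lemma hausdorff1_outer_empty: "hausdorff1_outer {} = 0"
  using hausdorff1_outer_mono[of "{}" "{undefined}"] by (simp add: hausdorff1_outer_singleton)

lemma hausdorff1_outer_countable_subadditive:
  "hausdorff1_outer (\<Union>i. A i) \<le> (\<Sum>i. hausdorff1_outer (A i))"
  unfolding hausdorff1_outer_def[of "\<Union>i. A i"]
proof (rule SUP_least)
  fix \<delta> :: real assume "\<delta> \<in> {0<..}"
  have "hausdorff1_pre \<delta> (\<Union>i. A i) \<le> (\<Sum>i. hausdorff1_pre \<delta> (A i))"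
    by (rule hausdorff1_pre_countable_subadditive)
  also have "\<dots> \<le> (\<Sum>i. hausdorff1_outer (A i))"
    using \<open>\<delta> \<in> {0<..}\<close> by (intro suminf_le hausdorff1_pre_le_outer) auto
  finally show "hausdorff1_pre \<delta> (\<Union>i. A i) \<le> (\<Sum>i. hausdorff1_outer (A i))" .
qed

text \<open>
  A set of diameter less than the gap \<open>r\<close> meets at most one of \<open>A\<close> and \<open>B\<close>, so a fine cover
  of the union splits into a cover of \<open>A\<close> and a cover of \<open>B\<close>.
\<close>

lemma hausdorff1_outer_metric:
  assumes "r > 0" and sep: "\<And>x y. x \<in> A \<Longrightarrow> y \<in> B \<Longrightarrow> r \<le> dist x y"
  shows "hausdorff1_outer A + hausdorff1_outer B \<le> hausdorff1_outer (A \<union> B)"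
proof -
  have small: "hausdorff1_pre \<delta> A + hausdorff1_pre \<delta> B \<le> hausdorff1_pre \<delta> (A \<union> B)"
    if "\<delta> < r" "\<delta> > 0" for \<delta>
    unfolding hausdorff1_pre_def[of \<delta> "A \<union> B"]
  proof (rule INF_greatest, clarify)
    fix C :: "nat \<Rightarrow> 'a set"
    assume C: "A \<union> B \<subseteq> (\<Union>i. C i)" "\<forall>i. bounded (C i) \<and> diameter (C i) \<le> \<delta>"
    define CA where "CA i = (if C i \<inter> A \<noteq> {} then C i else {})" for i
    define CB where "CB i = (if C i \<inter> A = {} then C i else {})" for i
    have notboth: "C i \<inter> A = {} \<or> C i \<inter> B = {}" for i
    proof (rule ccontr)
      assume "\<not> ?thesis"
      then obtain x y where "x \<in> C i" "x \<in> A" "y \<in> C i" "y \<in> B" by blast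
      then have "r \<le> dist x y" "dist x y \<le> \<delta>"
        using sep diameter_bounded_bound[of "C i" x y] C(2) order_trans by blast+
      then show False using \<open>\<delta> < r\<close> by simp
    qed
    have coverA: "A \<subseteq> (\<Union>i. CA i)" and coverB: "B \<subseteq> (\<Union>i. CB i)"
    proof -
      show "A \<subseteq> (\<Union>i. CA i)"
      proof
        fix x assume "x \<in> A"
        then obtain i where "x \<in> C i" using C(1) by auto
        with \<open>x \<in> A\<close> have "x \<in> CA i" by (auto simp: CA_def)
        then show "x \<in> (\<Union>i. CA i)" by (rule UN_I[OF UNIV_I])
      qed
      show "B \<subseteq> (\<Union>i. CB i)"
      proof
        fix x assume "x \<in> B"
        then obtain i where "x \<in> C i" using C(1) by auto
        with \<open>x \<in> B\<close> notboth[of i] have "x \<in> CB i" by (auto simp: CB_def)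
        then show "x \<in> (\<Union>i. CB i)" by (rule UN_I[OF UNIV_I])
      qed
    qed
    have "hausdorff1_pre \<delta> A \<le> (\<Sum>i. ennreal (diameter (CA i)))"
      by (rule hausdorff1_pre_le[OF coverA]) (use C(2) \<open>\<delta> > 0\<close> in \<open>auto simp: CA_def\<close>)
    moreover have "hausdorff1_pre \<delta> B \<le> (\<Sum>i. ennreal (diameter (CB i)))"
      by (rule hausdorff1_pre_le[OF coverB]) (use C(2) \<open>\<delta> > 0\<close> in \<open>auto simp: CB_def\<close>)
    ultimately have "hausdorff1_pre \<delta> A + hausdorff1_pre \<delta> B
        \<le> (\<Sum>i. ennreal (diameter (CA i))) + (\<Sum>i. ennreal (diameter (CB i)))"
      by (rule add_mono)
    also have "\<dots> = (\<Sum>i. ennreal (diameter (CA i)) + ennreal (diameter (CB i)))"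
      by (simp add: suminf_add)
    also have "\<dots> = (\<Sum>i. ennreal (diameter (C i)))"
      by (intro suminf_cong) (auto simp: CA_def CB_def)
    finally show "hausdorff1_pre \<delta> A + hausdorff1_pre \<delta> B \<le> (\<Sum>i. ennreal (diameter (C i)))" .
  qed
  have "hausdorff1_pre \<delta> A + hausdorff1_pre \<delta>' B \<le> hausdorff1_outer (A \<union> B)"
    if "\<delta> > 0" "\<delta>' > 0" for \<delta> \<delta>'
  proof -
    define d where "d = min (min \<delta> \<delta>') (r/2)"
    have d: "0 < d" "d < r" "d \<le> \<delta>" "d \<le> \<delta>'" using that \<open>r > 0\<close> by (auto simp: d_def)
    have "hausdorff1_pre \<delta> A + hausdorff1_pre \<delta>' B \<le> hausdorff1_pre d A + hausdorff1_pre d B"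
      using d by (intro add_mono hausdorff1_pre_antimono)
    also have "\<dots> \<le> hausdorff1_outer (A \<union> B)"
      using small[OF d(2,1)] hausdorff1_pre_le_outer[OF d(1), of "A \<union> B"] by (rule order_trans)
    finally show ?thesis .
  qed
  then show ?thesis
    unfolding hausdorff1_outer_def[of A] hausdorff1_outer_def[of B]
    by (subst ennreal_SUP_add_left[symmetric], simp, intro SUP_least,
        subst ennreal_SUP_add_right, simp, intro SUP_least, auto)
qed

text \<open>
  Caratheodory's criterion. The points of \<open>A\<close> at distance at least \<open>1/(n+1)\<close> from \<open>F\<close> are
  separated from \<open>F\<close>, so only the points of \<open>A - F\<close> closer to \<open>F\<close> could spoil additivity.
  These are cut into shells \<open>D k\<close> by their distance to \<open>F\<close>. Shells of indices with equal parity
  are separated from each other, so their measures add up to at most \<open>f A\<close>; hence the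
  measures of all shells form a convergent series, and its tails tend to \<open>0\<close>.
\<close>

lemma metric_outer_measure_cuts_closed:
  fixes f :: "'a::metric_space set \<Rightarrow> ennreal"
  assumes mono: "\<And>A B. A \<subseteq> B \<Longrightarrow> f A \<le> f B"
    and empty: "f {} = 0"
    and subadd: "\<And>A :: nat \<Rightarrow> 'a set. f (\<Union>i. A i) \<le> (\<Sum>i. f (A i))"
    and metric: "\<And>A B r. r > 0 \<Longrightarrow> (\<And>x y. x \<in> A \<Longrightarrow> y \<in> B \<Longrightarrow> r \<le> dist x y) \<Longrightarrow>
        f A + f B \<le> f (A \<union> B)"
    and F: "closed F" "F \<noteq> {}"
  shows "f (A \<inter> F) + f (A - F) \<le> f A"
proof (cases "f A = \<infinity>")
  case False
  define E where "E n = {x \<in> A. 1 / (real n + 1) \<le> infdist x F}" for n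
  define D where "D k = {x \<in> A. 1 / (real k + 2) \<le> infdist x F \<and> infdist x F < 1 / (real k + 1)}" for k
  have alternate: "(\<Sum>k<m. f (D (2 * k + p))) \<le> f (\<Union>k<m. D (2 * k + p))" for m p
  proof (induction m)
    case (Suc m)
    show ?case
    proof (cases "m = 0")
      case False
      let ?U = "\<Union>k<m. D (2 * k + p)"
      define r where "r = 1 / (real (2 * m + p)) - 1 / (real (2 * m + p) + 1)"
      have "1 / (real (2 * m + p) + 1) < 1 / real (2 * m + p)"
        using False by (intro divide_strict_left_mono) auto
      then have "r > 0" by (simp add: r_def)
      have "(\<Sum>k<Suc m. f (D (2 * k + p))) \<le> f ?U + f (D (2 * m + p))"
        using Suc by (simp add: add_mono)
      also have "\<dots> \<le> f (?U \<union> D (2 * m + p))"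
      proof (rule metric[OF \<open>r > 0\<close>])
        fix x y assume x: "x \<in> ?U" and y: "y \<in> D (2 * m + p)"
        obtain k where k: "k < m" "x \<in> D (2 * k + p)" using x by blast
        have "1 / real (2 * m + p) \<le> 1 / (real (2 * k + p) + 2)"
          using k(1) by (intro divide_left_mono) auto
        also have "\<dots> \<le> infdist x F" using k(2) by (simp add: D_def)
        also have "\<dots> \<le> infdist y F + dist x y" by (rule infdist_triangle)
        also have "infdist y F \<le> 1 / (real (2 * m + p) + 1)" using y by (simp add: D_def)
        finally show "r \<le> dist x y" by (simp add: r_def)
      qed
      finally show ?thesis by (simp add: lessThan_Suc Un_commute)
    qed auto
  qed (simp add: empty)
  have half: "(\<Sum>k<m. f (D (2 * k + p))) \<le> f A" for m p
    by (rule order_trans[OF alternate]) (auto intro!: mono simp: D_def)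
  have total: "(\<Sum>k. f (D k)) \<le> f A + f A"
    unfolding suminf_eq_SUP
  proof (rule SUP_least)
    fix n
    have split: "(\<Sum>k<2 * n. f (D k)) = (\<Sum>k<n. f (D (2 * k + 0))) + (\<Sum>k<n. f (D (2 * k + 1)))"
      by (induction n) (auto simp: algebra_simps)
    have "(\<Sum>k<n. f (D k)) \<le> (\<Sum>k<2 * n. f (D k))" by (intro sum_mono2) auto
    also have "\<dots> \<le> f A + f A" unfolding split by (intro add_mono half)
    finally show "(\<Sum>k<n. f (D k)) \<le> f A + f A" .
  qed
  then have fin: "(\<Sum>k. f (D k)) \<noteq> \<infinity>" using False by (auto simp: top_unique)
  \<comment> \<open>The initial part of the series is added on the left instead of bounding by a tail, so that the finite total can be cancelled once \<open>n\<close> has tended to infinity.\<close>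
  have step: "f (A \<inter> F) + f (A - F) + (\<Sum>k<n. f (D k)) \<le> f A + (\<Sum>k. f (D k))" for n
  proof -
    have cover: "A - F \<subseteq> (\<Union>i. case i of 0 \<Rightarrow> E n | Suc k \<Rightarrow> D (k + n))"
    proof
      fix x assume x: "x \<in> A - F"
      then have pos: "infdist x F > 0" using infdist_pos_not_in_closed[of F x] F by auto
      show "x \<in> (\<Union>i. case i of 0 \<Rightarrow> E n | Suc k \<Rightarrow> D (k + n))"
      proof (cases "x \<in> E n")
        case True
        then show ?thesis by (intro UN_I[of 0]) auto
      next
        case False
        let ?P = "\<lambda>m. 1 / (real m + 1) \<le> infdist x F"
        have "\<exists>m. ?P m"
          using reals_Archimedean[OF pos] by (auto simp: field_simps intro: less_imp_le)
        define m where "m = (LEAST m. ?P m)"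
        have "?P m" unfolding m_def by (rule LeastI_ex) fact
        have least: "\<not> ?P k" if "k < m" for k using that not_less_Least unfolding m_def by blast
        have "\<not> ?P n" using False x by (simp add: E_def)
        have "n < m"
        proof (rule ccontr)
          assume "\<not> n < m"
          then have "1 / (real n + 1) \<le> 1 / (real m + 1)" by (intro divide_left_mono) auto
          then show False using \<open>?P m\<close> \<open>\<not> ?P n\<close> by linarith
        qed
        define k where "k = m - 1 - n"
        have m: "m = Suc (k + n)" using \<open>n < m\<close> by (simp add: k_def)
        have "x \<in> D (k + n)"
          using \<open>?P m\<close> least[of "k + n"] x by (auto simp: D_def m algebra_simps)
        then show ?thesis by (intro UN_I[of "Suc k"]) auto
      qed
    qed
    have "f (A - F) \<le> (\<Sum>i. f (case i of 0 \<Rightarrow> E n | Suc k \<Rightarrow> D (k + n)))"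
      by (rule order_trans[OF mono[OF cover] subadd])
    also have "\<dots> = f (E n) + (\<Sum>k. f (D (k + n)))"
      by (subst suminf_offset[of _ 1]) (auto)
    finally have 1: "f (A - F) \<le> f (E n) + (\<Sum>k. f (D (k + n)))" .
    have "f (A \<inter> F) + f (E n) \<le> f (A \<inter> F \<union> E n)"
    proof (rule metric)
      show "0 < 1 / (real n + 1)" by simp
      fix x y assume "x \<in> A \<inter> F" "y \<in> E n"
      then show "1 / (real n + 1) \<le> dist x y"
        using infdist_le[of x F y] by (auto simp: E_def dist_commute)
    qed
    also have "\<dots> \<le> f A" by (rule mono) (auto simp: E_def)
    finally have 2: "f (A \<inter> F) + f (E n) \<le> f A" .
    have "f (A \<inter> F) + f (A - F) + (\<Sum>k<n. f (D k))
        \<le> f (A \<inter> F) + (f (E n) + (\<Sum>k. f (D (k + n)))) + (\<Sum>k<n. f (D k))"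
      using 1 by (intro add_mono) auto
    also have "\<dots> = (f (A \<inter> F) + f (E n)) + (\<Sum>k. f (D k))"
      by (subst suminf_offset[of "\<lambda>k. f (D k)" n]) (auto simp: ac_simps)
    also have "\<dots> \<le> f A + (\<Sum>k. f (D k))" using 2 by (rule add_right_mono)
    finally show ?thesis .
  qed
  have "f (A \<inter> F) + f (A - F) + (\<Sum>k. f (D k)) \<le> f A + (\<Sum>k. f (D k))"
    by (subst suminf_eq_SUP, subst ennreal_SUP_add_right, simp, intro SUP_least step)
  then show ?thesis using fin by (simp add: ennreal_add_left_cancel_le add.commute)
qed auto

text \<open>
  Since \<open>measure_of\<close> keeps the given set function only if that is countably additive, the content
  is that all Borel sets are Caratheodory measurable; by the previous lemma the closed ones are.
\<close>

lemma emeasure_hausdorff1: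
  assumes "A \<in> sets borel"
  shows "emeasure hausdorff1 A = hausdorff1_outer A"
proof -
  let ?f = "hausdorff1_outer :: 'a set \<Rightarrow> ennreal"
  let ?L = "lambda_system UNIV (Pow UNIV) ?f"
  interpret P: sigma_algebra "UNIV :: 'a set" "Pow UNIV" by (rule sigma_algebra_Pow)
  have oms: "outer_measure_space (Pow UNIV) ?f"
    by (auto simp: outer_measure_space_def positive_def increasing_def countably_subadditive_def
        hausdorff1_outer_empty hausdorff1_outer_mono hausdorff1_outer_countable_subadditive)
  have ms: "measure_space UNIV ?L ?f" by (rule P.caratheodory_lemma[OF oms])
  have closed_in: "F \<in> ?L" if "closed F" for F :: "'a set"
  proof -
    have "?f (A \<inter> F) + ?f (A - F) = ?f A" for A
    proof (rule antisym)
      show "?f (A \<inter> F) + ?f (A - F) \<le> ?f A"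
      proof (cases "F = {}")
        case False
        show ?thesis
          by (rule metric_outer_measure_cuts_closed[OF _ _ _ _ that False])
            (auto simp: hausdorff1_outer_empty hausdorff1_outer_mono
              hausdorff1_outer_countable_subadditive hausdorff1_outer_metric)
      qed (simp add: hausdorff1_outer_empty)
      let ?T = "(\<lambda>i::nat. case i of 0 \<Rightarrow> A \<inter> F | Suc k \<Rightarrow> (case k of 0 \<Rightarrow> A - F | Suc _ \<Rightarrow> {}))"
      have "?f A \<le> ?f (\<Union>i. ?T i)"
      proof (rule hausdorff1_outer_mono, rule subsetI)
        fix x assume "x \<in> A"
        then have "x \<in> ?T 0 \<or> x \<in> ?T (Suc 0)" by simp
        then show "x \<in> (\<Union>i. ?T i)" unfolding UN_iff using UNIV_I by metis
      qed
      also have "\<dots> \<le> (\<Sum>i. ?f (?T i))"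
        by (rule hausdorff1_outer_countable_subadditive)
      also have "\<dots> = ?f (A \<inter> F) + ?f (A - F)"
        by (subst suminf_offset[of _ 2]) (auto simp: numeral_2_eq_2 hausdorff1_outer_empty)
      finally show "?f A \<le> ?f (A \<inter> F) + ?f (A - F)" .
    qed
    then show ?thesis unfolding P.lambda_system_eq by simp
  qed
  have sub: "sets (borel :: 'a measure) \<subseteq> ?L"
  proof -
    have "sigma_algebra UNIV ?L" using ms by (simp add: measure_space_def)
    moreover have "Collect closed \<subseteq> ?L" using closed_in by blast
    ultimately have "sigma_sets UNIV (Collect closed) \<subseteq> ?L"
      by (rule sigma_algebra.sigma_sets_subset)
    then show ?thesis by (simp add: borel_eq_closed)
  qed
  have "measure_space UNIV (sets borel) ?f"
    using measure_down[OF ms _ sub] sets.sigma_algebra_axioms[of "borel :: 'a measure"] by simp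
  then show ?thesis
    unfolding hausdorff1_def using assms
    by (subst emeasure_measure_of_sigma) (auto simp: measure_space_def)
qed

lemma sets_hausdorff1 [simp, measurable_cong]: "sets hausdorff1 = sets borel"
  unfolding hausdorff1_def using sets.sigma_sets_eq[of borel] by (simp add: sets_measure_of_conv)

lemma space_hausdorff1 [simp]: "space hausdorff1 = UNIV"
  using sets_eq_imp_space_eq[OF sets_hausdorff1] by simp

section \<open>Hausdorff measure along a unit-speed curve\<close>

text \<open>
  Projection onto the direction \<open>v\<close> does not increase distances, so a cover of \<open>E\<close> yields a
  cover of its shadow by intervals of no greater length, and Lebesgue measure bounds their total
  length from below.
\<close>

lemma hausdorff1_outer_ge_projection:
  fixes E :: "'a::real_inner set"
  assumes "norm v \<le> 1" and sub: "{a<..<b} \<subseteq> (\<lambda>y. y \<bullet> v) ` E"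
  shows "ennreal (b - a) \<le> hausdorff1_outer E"
proof (cases "a < b")
  case True
  have "ennreal (b - a) \<le> hausdorff1_pre 1 E"
    unfolding hausdorff1_pre_def
  proof (rule INF_greatest, clarify)
    fix C :: "nat \<Rightarrow> 'a set"
    assume C: "E \<subseteq> (\<Union>i. C i)" "\<forall>i. bounded (C i) \<and> diameter (C i) \<le> 1"
    define P where "P i = (\<lambda>y. y \<bullet> v) ` C i" for i
    \<comment> \<open>The closed convex hull of the shadow of \<open>C i\<close>; the empty set is kept apart because \<open>Inf\<close> and \<open>Sup\<close> of it are arbitrary.\<close>
    define J where "J i = (if C i = {} then {} else {Inf (P i)..Sup (P i)})" for i
    have close: "x \<bullet> v - y \<bullet> v \<le> diameter (C i)" if "x \<in> C i" "y \<in> C i" for x y i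
    proof -
      have "x \<bullet> v - y \<bullet> v = (x - y) \<bullet> v" by (simp add: inner_diff_left)
      also have "\<dots> \<le> norm (x - y) * norm v" by (rule norm_cauchy_schwarz)
      also have "\<dots> \<le> norm (x - y)" using \<open>norm v \<le> 1\<close> by (simp add: mult_left_le)
      also have "\<dots> \<le> diameter (C i)"
        using diameter_bounded_bound[of "C i" x y] C(2) that by (simp add: dist_norm)
      finally show ?thesis .
    qed
    have bdd: "bdd_above (P i)" "bdd_below (P i)" for i
    proof -
      have "bounded (P i)" unfolding P_def
        using C(2) bounded_linear_image[OF _ bounded_linear_inner_left] by blast
      then show "bdd_above (P i)" "bdd_below (P i)"
        by (auto intro: bounded_imp_bdd_above bounded_imp_bdd_below)
    qed
    have width: "emeasure lborel (J i) \<le> ennreal (diameter (C i))" for i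
    proof (cases "C i = {}")
      case False
      then have ne: "P i \<noteq> {}" by (simp add: P_def)
      have "Sup (P i) \<le> Inf (P i) + diameter (C i)"
      proof (rule cSup_least[OF ne])
        fix s assume "s \<in> P i"
        then have "s - diameter (C i) \<le> Inf (P i)"
          using close[of _ i] by (intro cInf_greatest[OF ne]) (force simp: P_def)
        then show "s \<le> Inf (P i) + diameter (C i)" by simp
      qed
      moreover have "Inf (P i) \<le> Sup (P i)" using ne bdd by (intro cInf_le_cSup)
      ultimately show ?thesis using False by (simp add: J_def ennreal_leI)
    qed (simp add: J_def)
    have "{a<..<b} \<subseteq> (\<Union>i. J i)"
    proof
      fix t assume "t \<in> {a<..<b}"
      then obtain y where y: "y \<in> E" "t = y \<bullet> v" using sub by blast
      then obtain i where "y \<in> C i" using C(1) by blast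
      then have "t \<in> J i" using bdd[of i] y(2)
        by (auto simp: J_def P_def intro!: cINF_lower cSUP_upper)
      then show "t \<in> (\<Union>i. J i)" by blast
    qed
    then have "emeasure lborel {a<..<b} \<le> emeasure lborel (\<Union>i. J i)"
      by (intro emeasure_mono) (auto simp: J_def)
    also have "\<dots> \<le> (\<Sum>i. emeasure lborel (J i))"
      by (intro emeasure_subadditive_countably) (auto simp: J_def)
    also have "\<dots> \<le> (\<Sum>i. ennreal (diameter (C i)))"
      by (intro suminf_le width) auto
    finally show "ennreal (b - a) \<le> (\<Sum>i. ennreal (diameter (C i)))" using True by simp
  qed
  also have "\<dots> \<le> hausdorff1_outer E" by (rule hausdorff1_pre_le_outer) simp
  finally show ?thesis .
qed (simp add: ennreal_neg)

text \<open>
  Injectivity makes images commute with complements, so it suffices to treat closed sets; an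
  open set is a countable union of compact ones, and those have compact images.
\<close>

lemma borel_image_continuous_inj:
  fixes c :: "'a::euclidean_space \<Rightarrow> 'b::euclidean_space"
  assumes cont: "continuous_on UNIV c" and inj: "inj_on c D" and "open D" and "E \<in> sets borel"
  shows "c ` (E \<inter> D) \<in> sets borel"
proof -
  obtain K :: "nat \<Rightarrow> 'a set" where K: "\<And>n. compact (K n)" "D = (\<Union>n. K n)"
    using open_Union_compact_subsets[OF \<open>open D\<close>] by metis
  have closed: "c ` (F \<inter> D) \<in> sets borel" if "closed F" for F
  proof -
    have "c ` (F \<inter> D) = (\<Union>n. c ` (F \<inter> K n))" using K(2) by auto
    moreover have "compact (c ` (F \<inter> K n))" for n
      by (intro compact_continuous_image continuous_on_subset[OF cont] closed_Int_compact that K(1)) auto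
    ultimately show ?thesis
      by (simp only:) (intro sets.countable_UN'' borel_compact, auto)
  qed
  have "E \<in> sigma_sets UNIV (Collect closed)"
    using \<open>E \<in> sets borel\<close> by (simp add: borel_eq_closed)
  then show ?thesis
  proof induction
    case (Compl A)
    have "c ` ((UNIV - A) \<inter> D) = c ` (UNIV \<inter> D) - c ` (A \<inter> D)"
      using inj by (auto dest: inj_onD)
    then show ?case using Compl closed[of UNIV] by auto
  next
    case (Union A)
    then show ?case by (auto simp: image_UN Int_UN_distrib2 simp flip: UN_simps)
  qed (use closed in auto)
qed

locale unit_speed_curve =
  fixes c c' :: "real \<Rightarrow> 'a::euclidean_space"
  assumes has_deriv: "\<And>t. (c has_vector_derivative c' t) (at t)"
    and cont_deriv: "continuous_on UNIV c'"
    and unit: "\<And>t. norm (c' t) = 1"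
begin

lemma cont: "continuous_on S c"
  using has_deriv by (intro continuous_at_imp_continuous_on) (auto intro: has_vector_derivative_continuous)

lemma borel_measurable_curve [measurable]: "c \<in> borel_measurable borel"
  using cont by (rule borel_measurable_continuous_onI)

lemma norm_diff_le: "norm (c s - c t) \<le> \<bar>s - t\<bar>"
proof -
  have "norm (c s - c t) \<le> 1 * norm (s - t)"
  proof (rule differentiable_bound[of UNIV])
    show "(c has_derivative (\<lambda>h. h *\<^sub>R c' x)) (at x within UNIV)" for x
      using has_deriv[of x] by (simp add: has_vector_derivative_def)
    show "onorm (\<lambda>h. h *\<^sub>R c' x) \<le> 1" for x
      by (rule onorm_le) (simp add: unit)
  qed auto
  then show ?thesis by simp
qed

text \<open>
  The interval is cut into \<open>N\<close> pieces of length \<open>h \<le> \<delta>\<close>; the curve does not increase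
  distances, so the arcs over these pieces have diameter at most \<open>h\<close>.
\<close>

lemma hausdorff1_outer_image_le:
  assumes "p \<le> q"
  shows "hausdorff1_outer (c ` {p<..<q}) \<le> ennreal (q - p)"
proof (cases "p = q")
  case False
  with assms have "p < q" by simp
  show ?thesis
    unfolding hausdorff1_outer_def
  proof (rule SUP_least)
    fix \<delta> :: real assume "\<delta> \<in> {0<..}"
    then have "\<delta> > 0" by simp
    obtain N :: nat where N: "(q - p) / \<delta> < real N" using reals_Archimedean2 by blast
    have "N > 0" using N \<open>p < q\<close> \<open>\<delta> > 0\<close> by (metis diff_gt_0_iff_gt divide_pos_pos less_trans of_nat_0_less_iff)
    define h where "h = (q - p) / real N"
    have h: "h > 0" "h \<le> \<delta>" "real N * h = q - p"
      using N \<open>N > 0\<close> \<open>p < q\<close> \<open>\<delta> > 0\<close> by (auto simp: h_def field_simps)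
    define C where "C i = (if i < N then c ` {p + real i * h .. p + (real i + 1) * h} else {})" for i
    have diam: "bounded (C i) \<and> diameter (C i) \<le> h" for i
    proof
      show "bounded (C i)"
        unfolding C_def by (auto intro!: compact_imp_bounded compact_continuous_image cont)
      show "diameter (C i) \<le> h"
      proof (rule diameter_le)
        fix x y assume "x \<in> C i" "y \<in> C i"
        then obtain s t where st: "x = c s" "y = c t"
          "s \<in> {p + real i * h .. p + (real i + 1) * h}" "t \<in> {p + real i * h .. p + (real i + 1) * h}"
          by (auto simp: C_def split: if_splits)
        then have "\<bar>s - t\<bar> \<le> h" by (auto simp: algebra_simps)
        then show "norm (x - y) \<le> h" using norm_diff_le[of s t] st by simp
      qed (use h in auto)
    qed
    have "c ` {p<..<q} \<subseteq> (\<Union>i. C i)"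
    proof clarify
      fix t assume t: "t \<in> {p<..<q}"
      define i where "i = nat \<lfloor>(t - p) / h\<rfloor>"
      have nn: "0 \<le> (t - p) / h" using t h by simp
      have i: "real i \<le> (t - p) / h" "(t - p) / h < real i + 1"
        using nn by (auto simp: i_def)
      have "t - p < real N * h" using t h by simp
      then have "(t - p) / h < real N" using h(1) by (simp add: pos_divide_less_eq)
      then have "i < N" using i(1) by linarith
      moreover have "t \<in> {p + real i * h .. p + (real i + 1) * h}"
        using i h(1) by (auto simp: field_simps)
      ultimately have "c t \<in> C i" by (simp add: C_def)
      then show "c t \<in> (\<Union>i. C i)" by blast
    qed
    then have "hausdorff1_pre \<delta> (c ` {p<..<q}) \<le> (\<Sum>i. ennreal (diameter (C i)))"
      by (rule hausdorff1_pre_le) (use diam h(2) order_trans in blast)+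
    also have "\<dots> = (\<Sum>i<N. ennreal (diameter (C i)))"
      by (rule suminf_finite) (auto simp: C_def)
    also have "\<dots> \<le> (\<Sum>i<N. ennreal h)"
      using diam by (intro sum_mono ennreal_leI) auto
    also have "\<dots> = ennreal (q - p)"
      using h by (simp add: ennreal_of_nat_eq_real_of_nat ennreal_mult'[symmetric])
    finally show "hausdorff1_pre \<delta> (c ` {p<..<q}) \<le> ennreal (q - p)" .
  qed
qed (simp add: hausdorff1_outer_empty)

lemma borel_image:
  assumes "inj_on c D" "open D" "E \<in> sets borel"
  shows "c ` (E \<inter> D) \<in> sets borel"
  using borel_image_continuous_inj[OF cont assms] .

lemma chord_along_tangent:
  assumes "u \<le> v" and near: "\<And>t. u \<le> t \<Longrightarrow> t \<le> v \<Longrightarrow> norm (c' t - c' x) \<le> e"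
  shows "(1 - e) * (v - u) \<le> (c v - c u) \<bullet> c' x"
proof -
  have "(\<lambda>t. c t \<bullet> c' x - (1 - e) * t) u \<le> (\<lambda>t. c t \<bullet> c' x - (1 - e) * t) v"
  proof (rule DERIV_nonneg_imp_nondecreasing[OF \<open>u \<le> v\<close>])
    fix t assume t: "u \<le> t" "t \<le> v"
    have "((\<lambda>t. c t \<bullet> c' x) has_real_derivative c' t \<bullet> c' x) (at t)"
      unfolding has_real_derivative_iff_has_vector_derivative
      using bounded_linear.has_vector_derivative[OF bounded_linear_inner_left has_deriv] .
    then have "((\<lambda>t. c t \<bullet> c' x - (1 - e) * t) has_real_derivative c' t \<bullet> c' x - (1 - e)) (at t)"
      by (auto intro!: derivative_eq_intros)
    moreover have "c' t \<bullet> c' x \<ge> 1 - e"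
    proof -
      have "c' t \<bullet> c' x = c' x \<bullet> c' x + (c' t - c' x) \<bullet> c' x" by (simp add: inner_diff_left)
      moreover have "\<bar>(c' t - c' x) \<bullet> c' x\<bar> \<le> norm (c' t - c' x) * norm (c' x)"
        by (rule Cauchy_Schwarz_ineq2)
      moreover have "c' x \<bullet> c' x = 1" using unit[of x] by (simp add: norm_eq_1)
      ultimately show ?thesis using near[OF t] unit[of x] by auto
    qed
    ultimately show "\<exists>y. ((\<lambda>t. c t \<bullet> c' x - (1 - e) * t) has_real_derivative y) (at t) \<and> 0 \<le> y"
      by (intro exI[of _ "c' t \<bullet> c' x - (1 - e)"]) simp
  qed
  then show ?thesis by (simp add: inner_diff_left algebra_simps)
qed

text \<open>
  For the lower bound, an arc near \<open>c x\<close> is projected to the tangent at \<open>x\<close>: as \<open>c'\<close> is continuous,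
  its shadow has length at least \<open>(1 - e)\<close> times the parameter length. Additivity of
  Hausdorff measure on disjoint arcs makes this local bound global by bisection.
\<close>

lemma hausdorff1_outer_image_interval:
  assumes "p \<le> q" and inj: "inj_on c {p<..<q}"
  shows "hausdorff1_outer (c ` {p<..<q}) = ennreal (q - p)"
proof (rule antisym[OF hausdorff1_outer_image_le[OF \<open>p \<le> q\<close>]])
  have approx: "ennreal ((1 - e) * (q - p)) \<le> hausdorff1_outer (c ` {p<..<q})" if "e > 0" "e < 1" for e
  proof -
    define Q where "Q u v \<longleftrightarrow> (p \<le> u \<longrightarrow> v \<le> q \<longrightarrow> u \<le> v \<longrightarrow>
        ennreal ((1 - e) * (v - u)) \<le> hausdorff1_outer (c ` {u<..<v}))" for u v
    have "Q p q"
    proof (rule Bolzano[OF \<open>p \<le> q\<close>])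
      fix u v w assume "Q u v" "Q v w" "u \<le> v" "v \<le> w"
      show "Q u w" unfolding Q_def
      proof (intro impI)
        assume *: "p \<le> u" "w \<le> q" "u \<le> w"
        have bor: "c ` {s<..<t} \<in> sets borel" if "p \<le> s" "t \<le> q" for s t
        proof -
          have "{s<..<t} \<subseteq> {p<..<q}" using that by auto
          then show ?thesis
            using borel_image[OF inj_on_subset[OF inj], of "{s<..<t}" UNIV] by simp
        qed
        have "ennreal ((1 - e) * (w - u)) = ennreal ((1 - e) * (v - u)) + ennreal ((1 - e) * (w - v))"
        proof -
          have "(1 - e) * (w - u) = (1 - e) * (v - u) + (1 - e) * (w - v)" by (simp add: algebra_simps)
          then show ?thesis using \<open>e < 1\<close> \<open>u \<le> v\<close> \<open>v \<le> w\<close> by simp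
        qed
        also have "\<dots> \<le> hausdorff1_outer (c ` {u<..<v}) + hausdorff1_outer (c ` {v<..<w})"
          using \<open>Q u v\<close> \<open>Q v w\<close> * \<open>u \<le> v\<close> \<open>v \<le> w\<close> by (intro add_mono) (auto simp: Q_def)
        also have "\<dots> = emeasure hausdorff1 (c ` {u<..<v}) + emeasure hausdorff1 (c ` {v<..<w})"
          using bor * \<open>u \<le> v\<close> \<open>v \<le> w\<close> by (simp add: emeasure_hausdorff1)
        also have "\<dots> = emeasure hausdorff1 (c ` {u<..<v} \<union> c ` {v<..<w})"
        proof (rule plus_emeasure)
          show "c ` {u<..<v} \<inter> c ` {v<..<w} = {}"
            using * \<open>u \<le> v\<close> \<open>v \<le> w\<close> by (auto dest!: inj_onD[OF inj])
        qed (use bor * \<open>u \<le> v\<close> \<open>v \<le> w\<close> in auto)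
        also have "\<dots> = hausdorff1_outer (c ` {u<..<v} \<union> c ` {v<..<w})"
          using bor * \<open>u \<le> v\<close> \<open>v \<le> w\<close> by (intro emeasure_hausdorff1 sets.Un) auto
        also have "\<dots> \<le> hausdorff1_outer (c ` {u<..<w})"
          using \<open>u \<le> v\<close> \<open>v \<le> w\<close> by (intro hausdorff1_outer_mono) auto
        finally show "ennreal ((1 - e) * (w - u)) \<le> hausdorff1_outer (c ` {u<..<w})" .
      qed
    next
      fix x
      have "isCont c' x" using cont_deriv by (simp add: continuous_on_eq_continuous_at)
      then obtain d where d: "d > 0" "\<And>t. \<bar>t - x\<bar> < d \<Longrightarrow> norm (c' t - c' x) < e"
        using \<open>e > 0\<close> unfolding continuous_at_eps_delta by (auto simp: dist_norm)
      show "\<exists>d>0. \<forall>u v. u \<le> x \<and> x \<le> v \<and> v - u < d \<longrightarrow> Q u v"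
      proof (intro exI[of _ d] conjI allI impI d(1))
        fix u v assume uv: "u \<le> x \<and> x \<le> v \<and> v - u < d"
        have chord: "(1 - e) * (v - u) \<le> (c v - c u) \<bullet> c' x"
          using uv by (intro chord_along_tangent less_imp_le[OF d(2)]) auto
        have "{c u \<bullet> c' x<..<c v \<bullet> c' x} \<subseteq> (\<lambda>y. y \<bullet> c' x) ` (c ` {u<..<v})"
        proof
          fix y assume y: "y \<in> {c u \<bullet> c' x<..<c v \<bullet> c' x}"
          have "\<exists>t\<ge>u. t \<le> v \<and> c t \<bullet> c' x = y"
            by (rule IVT') (use y uv in \<open>auto intro!: continuous_intros cont\<close>)
          then obtain t where t: "u \<le> t" "t \<le> v" "c t \<bullet> c' x = y" by blast
          then have "t \<in> {u<..<v}" using y by (auto simp: less_le)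
          then show "y \<in> (\<lambda>y. y \<bullet> c' x) ` (c ` {u<..<v})" using t(3) by blast
        qed
        then have "ennreal (c v \<bullet> c' x - c u \<bullet> c' x) \<le> hausdorff1_outer (c ` {u<..<v})"
          by (rule hausdorff1_outer_ge_projection[rotated]) (simp add: unit)
        moreover have "ennreal ((1 - e) * (v - u)) \<le> ennreal (c v \<bullet> c' x - c u \<bullet> c' x)"
          using chord by (intro ennreal_leI) (simp add: inner_diff_left)
        ultimately show "Q u v" unfolding Q_def by auto
      qed
    qed
    then show ?thesis using \<open>p \<le> q\<close> by (simp add: Q_def)
  qed
  show "ennreal (q - p) \<le> hausdorff1_outer (c ` {p<..<q})"
  proof (cases "hausdorff1_outer (c ` {p<..<q})")
    case (real r)
    have "q - p \<le> r"
    proof (rule field_le_mult_one_interval)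
      fix z :: real assume "0 < z" "z < 1"
      then show "z * (q - p) \<le> r" using approx[of "1 - z"] real by (simp add: ennreal_le_iff)
    qed
    then show ?thesis using real by (simp add: ennreal_leI)
  qed simp
qed

text \<open>
  Pulling \<open>hausdorff1\<close> back along \<open>c\<close> gives a Borel measure on the line that agrees with
  Lebesgue measure on open intervals inside \<open>D\<close>, and these determine it. The cases for \<open>D\<close> are
  the interiors of the two kinds of offset range.
\<close>

lemma emeasure_hausdorff1_image:
  assumes D: "D = UNIV \<or> (\<exists>a b. D = {a<..<b})" and inj: "inj_on c D" and E: "E \<in> sets borel"
  shows "emeasure hausdorff1 (c ` (E \<inter> D)) = emeasure lborel (E \<inter> D)"
proof -
  have "open D" using D by auto
  have Dbor [measurable]: "D \<in> sets borel" using \<open>open D\<close> by auto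
  have bor: "c ` (A \<inter> D) \<in> sets borel" if "A \<in> sets borel" for A
    using borel_image[OF inj \<open>open D\<close> that] .
  define M where "M = density lborel (indicator D)"
  define N where "N = distr (restrict_space hausdorff1 (c ` D)) borel (the_inv_into D c)"
  have cD: "c ` D \<in> sets borel" using bor[of UNIV] by simp
  have vimage: "the_inv_into D c -` A \<inter> c ` D = c ` (A \<inter> D)" for A
    using the_inv_into_f_f[OF inj] by auto
  have meas: "the_inv_into D c \<in> measurable (restrict_space hausdorff1 (c ` D)) borel"
  proof (rule measurableI)
    fix A :: "real set" assume "A \<in> sets borel"
    then show "the_inv_into D c -` A \<inter> space (restrict_space hausdorff1 (c ` D))
        \<in> sets (restrict_space hausdorff1 (c ` D))"
      using bor[of A] cD by (auto simp: space_restrict_space vimage sets_restrict_space_iff)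
  qed simp
  have emN: "emeasure N A = emeasure hausdorff1 (c ` (A \<inter> D))" if "A \<in> sets borel" for A
    unfolding N_def using that cD
    by (subst emeasure_distr[OF meas])
       (auto simp: space_restrict_space vimage emeasure_restrict_space image_mono)
  have emM: "emeasure M A = emeasure lborel (A \<inter> D)" if "A \<in> sets borel" for A
    unfolding M_def using that by (subst emeasure_restricted) (auto simp: Int_commute)
  have box: "emeasure N {a<..<b} = emeasure lborel ({a<..<b} \<inter> D)" for a b
  proof -
    have "\<exists>p q. {a<..<b} \<inter> D = {p<..<q}"
      using D
    proof
      assume "\<exists>l r. D = {l<..<r}"
      then obtain l r where "D = {l<..<r}" by blast
      then have "{a<..<b} \<inter> D = {max a l<..<min b r}" by auto
      then show ?thesis by blast
    qed auto
    then obtain p q where pq: "{a<..<b} \<inter> D = {p<..<q}" by blast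
    have "inj_on c {p<..<q}" using inj pq by (metis inj_on_subset inf_le2)
    then have "hausdorff1_outer (c ` {p<..<q}) = emeasure lborel {p<..<q}"
      using hausdorff1_outer_image_interval[of p q]
      by (cases "p \<le> q") (auto simp: hausdorff1_outer_empty)
    then show ?thesis using bor[of "{a<..<b}"] by (simp add: emN emeasure_hausdorff1 pq)
  qed
  have "M = N"
  proof (rule measure_eqI_generator_eq)
    let ?E = "range (\<lambda>(a, b). {a<..<b::real})"
    let ?A = "\<lambda>n::nat. {- real n<..<real n}"
    show "Int_stable ?E" by (auto simp: Int_stable_def)
    have gen: "sets (borel :: real measure) = sigma_sets UNIV ?E"
    proof -
      have "(\<lambda>(a, b). box a b) = (\<lambda>(a, b). {a<..<b::real})" by (auto simp: box_real)
      then have "?E = range (\<lambda>(a, b). box a b)" by simp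
      moreover have "sets borel = sigma_sets UNIV (range (\<lambda>(a, b). box a b :: real set))"
        by (subst borel_eq_box) simp
      ultimately show ?thesis by (simp only:)
    qed
    show "?E \<subseteq> Pow UNIV" "sets M = sigma_sets UNIV ?E" "sets N = sigma_sets UNIV ?E"
      using gen by (simp_all add: M_def N_def)
    show "range ?A \<subseteq> ?E" by auto
    show "(\<Union>i. ?A i) = UNIV" using UN_box_eq_UNIV[where 'a=real] by (simp add: box_real)
    show "emeasure M (?A i) \<noteq> \<infinity>" for i
    proof -
      have "emeasure M (?A i) = emeasure lborel (?A i \<inter> D)" by (rule emM) simp
      also have "\<dots> \<le> emeasure lborel (?A i)" by (rule emeasure_mono) auto
      also have "\<dots> < \<infinity>" by simp
      finally show ?thesis by simp
    qed
    show "emeasure M X = emeasure N X" if "X \<in> ?E" for X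
      using that by (auto simp: emM box)
  qed
  then show ?thesis using emN[OF E] emM[OF E] by simp
qed

lemma density_hausdorff1_image:
  assumes D: "D = UNIV \<or> (\<exists>a b. D = {a<..<b})" and inj: "inj_on c D"
  shows "density hausdorff1 (indicator (c ` D)) = distr (density lborel (indicator D)) borel c"
proof (rule measure_eqI)
  have Dbor [measurable]: "open D" "D \<in> sets borel" using D by auto
  have cD: "c ` D \<in> sets borel" using borel_image[OF inj Dbor(1), of UNIV] by simp
  fix A assume "A \<in> sets (density hausdorff1 (indicator (c ` D)))"
  then have A [measurable]: "A \<in> sets borel" by simp
  have pre: "c -` A \<in> sets borel" using measurable_sets[OF borel_measurable_curve A] by simp
  have "c ` D \<inter> A = c ` (c -` A \<inter> D)" by auto
  then show "emeasure (density hausdorff1 (indicator (c ` D))) A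
      = emeasure (distr (density lborel (indicator D)) borel c) A"
    using A cD pre emeasure_hausdorff1_image[OF D inj pre]
    by (simp add: emeasure_restricted emeasure_distr Int_commute)
qed simp

lemma hausdorff1_image_transfer:
  fixes F :: "'a \<Rightarrow> 'b::{banach, second_countable_topology}"
  assumes D: "D = UNIV \<or> (\<exists>a b. D = {a<..<b})" and inj: "inj_on c D"
    and F [measurable]: "F \<in> borel_measurable borel" and S [measurable]: "S \<in> sets borel"
  shows "set_integrable hausdorff1 (c ` D \<inter> S) F \<longleftrightarrow> set_integrable lborel {w \<in> D. c w \<in> S} (\<lambda>w. F (c w))"
    and "(LINT y:c ` D \<inter> S|hausdorff1. F y) = (LINT w:{w \<in> D. c w \<in> S}|lborel. F (c w))"
proof -
  have Dbor [measurable]: "open D" "D \<in> sets borel" using D by auto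
  have cD [measurable]: "c ` D \<in> sets borel" using borel_image[OF inj Dbor(1), of UNIV] by simp
  let ?G = "\<lambda>y. indicator S y *\<^sub>R F y"
  have G: "?G \<in> borel_measurable hausdorff1" "?G \<in> borel_measurable borel"
    by (simp_all add: measurable_cong_sets[OF sets_hausdorff1 refl])
  have H: "(\<lambda>y. indicat_real (c ` D) y) \<in> borel_measurable hausdorff1"
    by (simp add: measurable_cong_sets[OF sets_hausdorff1 refl])
  have eq: "density hausdorff1 (\<lambda>y. ennreal (indicat_real (c ` D) y))
      = distr (density lborel (\<lambda>w. ennreal (indicat_real D w))) borel c"
    using density_hausdorff1_image[OF D inj] by (simp add: ennreal_indicator)
  have l: "indicat_real (c ` D) y *\<^sub>R ?G y = indicat_real (c ` D \<inter> S) y *\<^sub>R F y" for y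
    by (auto simp: indicator_def)
  have r: "indicat_real D w *\<^sub>R ?G (c w) = indicat_real {w \<in> D. c w \<in> S} w *\<^sub>R F (c w)" for w
    by (auto simp: indicator_def)
  have "integrable hausdorff1 (\<lambda>y. indicat_real (c ` D) y *\<^sub>R ?G y)
      \<longleftrightarrow> integrable (density hausdorff1 (\<lambda>y. ennreal (indicat_real (c ` D) y))) ?G"
    by (rule integrable_density[symmetric]) (use G H in auto)
  also have "\<dots> \<longleftrightarrow> integrable (density lborel (\<lambda>w. ennreal (indicat_real D w))) (\<lambda>w. ?G (c w))"
    unfolding eq by (rule integrable_distr_eq) (use G in auto)
  also have "\<dots> \<longleftrightarrow> integrable lborel (\<lambda>w. indicat_real D w *\<^sub>R ?G (c w))"
    by (rule integrable_density) auto
  finally show "set_integrable hausdorff1 (c ` D \<inter> S) F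
      \<longleftrightarrow> set_integrable lborel {w \<in> D. c w \<in> S} (\<lambda>w. F (c w))"
    unfolding set_integrable_def l r .
  have "integral\<^sup>L hausdorff1 (\<lambda>y. indicat_real (c ` D) y *\<^sub>R ?G y)
      = integral\<^sup>L (density hausdorff1 (\<lambda>y. ennreal (indicat_real (c ` D) y))) ?G"
    by (rule integral_density[symmetric]) (use G H in auto)
  also have "\<dots> = integral\<^sup>L (density lborel (\<lambda>w. ennreal (indicat_real D w))) (\<lambda>w. ?G (c w))"
    unfolding eq by (rule integral_distr) (use G in auto)
  also have "\<dots> = integral\<^sup>L lborel (\<lambda>w. indicat_real D w *\<^sub>R ?G (c w))"
    by (rule integral_density) auto
  finally show "(LINT y:c ` D \<inter> S|hausdorff1. F y) = (LINT w:{w \<in> D. c w \<in> S}|lborel. F (c w))"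
    unfolding set_lebesgue_integral_def l r .
qed

end

section \<open>Curvature of tangent circles\<close>

lemma vderivI:
  "(f has_vector_derivative f') (at t) \<Longrightarrow> vderiv f t = f'"
  by (simp add: vderiv_def vector_derivative_at)

text \<open>
  With \<open>u\<close> pointing from the centre to the starting point, the curvature vector there points back to
  the centre.
\<close>

lemma
  fixes c u v :: "'a::real_inner"
  assumes "r \<noteq> 0"
  defines "\<sigma> \<equiv> \<lambda>s. c + r *\<^sub>R (cos (s / r) *\<^sub>R u + sin (s / r) *\<^sub>R v)"
  shows vderiv_circle: "vderiv \<sigma> = (\<lambda>s. cos (s / r) *\<^sub>R v - sin (s / r) *\<^sub>R u)"
    and curvature_vector_circle: "curvature_vector \<sigma> 0 = - (1 / r) *\<^sub>R u"
proof -
  have "(\<sigma> has_vector_derivative cos (s / r) *\<^sub>R v - sin (s / r) *\<^sub>R u) (at s)" for s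
  proof -
    have cs: "((\<lambda>s. cos (s / r)) has_real_derivative - sin (s / r) / r) (at s)"
        "((\<lambda>s. sin (s / r)) has_real_derivative cos (s / r) / r) (at s)"
      using \<open>r \<noteq> 0\<close> by (auto intro!: derivative_eq_intros)
    have "(\<sigma> has_vector_derivative
        0 + r *\<^sub>R (cos (s / r) *\<^sub>R 0 + (- sin (s / r) / r) *\<^sub>R u
          + (sin (s / r) *\<^sub>R 0 + (cos (s / r) / r) *\<^sub>R v))) (at s)"
      unfolding \<sigma>_def
      by (intro has_vector_derivative_add has_vector_derivative_const
          bounded_linear.has_vector_derivative[OF bounded_linear_scaleR_right]
          has_vector_derivative_scaleR cs)
    moreover have "0 + r *\<^sub>R (cos (s / r) *\<^sub>R 0 + (- sin (s / r) / r) *\<^sub>R u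
        + (sin (s / r) *\<^sub>R 0 + (cos (s / r) / r) *\<^sub>R v)) = cos (s / r) *\<^sub>R v - sin (s / r) *\<^sub>R u"
      using \<open>r \<noteq> 0\<close> by (simp add: algebra_simps)
    ultimately show ?thesis by metis
  qed
  then show *: "vderiv \<sigma> = (\<lambda>s. cos (s / r) *\<^sub>R v - sin (s / r) *\<^sub>R u)"
    by (intro ext vderivI)
  have "((\<lambda>s. cos (s / r) *\<^sub>R v - sin (s / r) *\<^sub>R u) has_vector_derivative - (1 / r) *\<^sub>R u) (at 0)"
  proof -
    have cs: "((\<lambda>s. cos (s / r)) has_real_derivative 0) (at 0)"
        "((\<lambda>s. sin (s / r)) has_real_derivative 1 / r) (at 0)"
      using \<open>r \<noteq> 0\<close> by (auto intro!: derivative_eq_intros)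
    have "((\<lambda>s. cos (s / r) *\<^sub>R v - sin (s / r) *\<^sub>R u) has_vector_derivative
        (cos (0 / r) *\<^sub>R 0 + 0 *\<^sub>R v) - (sin (0 / r) *\<^sub>R 0 + (1 / r) *\<^sub>R u)) (at 0)"
      by (intro has_vector_derivative_diff has_vector_derivative_const has_vector_derivative_scaleR cs)
    then show ?thesis by simp
  qed
  then show "curvature_vector \<sigma> 0 = - (1 / r) *\<^sub>R u"
    unfolding curvature_vector_def * by (rule vderivI)
qed

text \<open>
  Let \<open>p\<close> be the normal part of \<open>d = y - \<gamma> x\<close>. A circle of radius \<open>r\<close> with centre \<open>\<gamma> x + r n\<close>, \<open>n\<close> a unit normal, passes
  through \<open>y\<close> iff \<open>|d|\<^sup>2 = 2 r (d \<bullet> n)\<close>; as \<open>y\<close> also lies in the plane of the circle, \<open>n = p / |p|\<close>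
  and \<open>1/r = 2 |p| / |d|\<^sup>2\<close>. For \<open>y\<close> on the tangent line \<open>p\<close> vanishes, which matches the
  conventional value \<open>0\<close>.
\<close>

lemma circle_curvature_eq:
  fixes \<gamma> :: "real \<Rightarrow> 'a::real_inner"
  assumes unit: "norm (vderiv \<gamma> x) = 1"
  shows "circle_curvature \<gamma> x y =
    (2 / (norm (y - \<gamma> x))\<^sup>2) *\<^sub>R perp_proj (vderiv \<gamma> x) (y - \<gamma> x)"
proof -
  define \<tau> where "\<tau> = vderiv \<gamma> x"
  define d where "d = y - \<gamma> x"
  define p where "p = perp_proj \<tau> d"
  have tt: "\<tau> \<bullet> \<tau> = 1" using unit by (simp add: \<tau>_def norm_eq_1)
  have p: "p = d - (d \<bullet> \<tau>) *\<^sub>R \<tau>" by (simp add: p_def perp_proj_def tt)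
  show ?thesis
  proof (cases "\<exists>a. y = \<gamma> x + a *\<^sub>R \<tau>")
    case True
    then obtain a where "d = a *\<^sub>R \<tau>" unfolding d_def by (metis add_diff_cancel_left')
    then have "p = 0" by (simp add: p tt)
    then show ?thesis using True by (simp add: circle_curvature_def p_def d_def \<tau>_def)
  next
    case False
    have "p \<noteq> 0"
    proof
      assume "p = 0"
      then have "y = \<gamma> x + (d \<bullet> \<tau>) *\<^sub>R \<tau>" using p by (simp add: d_def)
      then show False using False by blast
    qed
    have "d \<noteq> 0" using False[unfolded not_ex, rule_format, of 0] by (auto simp: d_def)
    have pt: "p \<bullet> \<tau> = 0" by (simp add: p inner_diff_left tt)
    have dd: "(norm d)\<^sup>2 = (d \<bullet> \<tau>)\<^sup>2 + (norm p)\<^sup>2"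
      unfolding power2_norm_eq_inner p
      by (simp add: inner_diff_left inner_diff_right tt inner_commute[of \<tau> d] power2_eq_square)
    define k where "k = (2 / (norm d)\<^sup>2) *\<^sub>R p"
    have "(THE k. \<exists>\<sigma>. tangent_circle \<gamma> x \<sigma> \<and> y \<in> range \<sigma> \<and> k = curvature_vector \<sigma> 0) = k"
    proof (rule the_equality)
      define r where "r = (norm d)\<^sup>2 / (2 * norm p)"
      define n where "n = (1 / norm p) *\<^sub>R p"
      define \<sigma> where "\<sigma> = (\<lambda>s. (\<gamma> x + r *\<^sub>R n) + r *\<^sub>R (cos (s / r) *\<^sub>R (- n) + sin (s / r) *\<^sub>R \<tau>))"
      have r: "r > 0" using \<open>p \<noteq> 0\<close> \<open>d \<noteq> 0\<close> by (simp add: r_def)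
      have "norm n = 1" using \<open>p \<noteq> 0\<close> by (simp add: n_def)
      have nt: "n \<bullet> \<tau> = 0" by (simp add: n_def pt)
      have circ: "arc_length_circle \<sigma>"
        unfolding arc_length_circle_def \<sigma>_def
        using r \<open>norm n = 1\<close> nt unit
        by (intro exI[of _ "\<gamma> x + r *\<^sub>R n"] exI[of _ r] exI[of _ "- n"] exI[of _ \<tau>]) (auto simp: \<tau>_def)
      have "\<sigma> 0 = \<gamma> x" by (simp add: \<sigma>_def)
      moreover have "vderiv \<sigma> 0 = \<tau>"
        unfolding \<sigma>_def by (subst vderiv_circle) (use r in auto)
      ultimately have tang: "tangent_circle \<gamma> x \<sigma>" using circ by (simp add: tangent_circle_def \<tau>_def)
      have kn: "k = curvature_vector \<sigma> 0"
        unfolding \<sigma>_def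
        by (subst curvature_vector_circle)
           (use r \<open>p \<noteq> 0\<close> \<open>d \<noteq> 0\<close> in \<open>auto simp: k_def n_def r_def\<close>)
      have "((r - norm p) / r)\<^sup>2 + ((d \<bullet> \<tau>) / r)\<^sup>2 = 1"
      proof -
        have "2 * r * norm p = (norm d)\<^sup>2" using \<open>p \<noteq> 0\<close> by (simp add: r_def)
        then have "(r - norm p)\<^sup>2 + (d \<bullet> \<tau>)\<^sup>2 = r\<^sup>2" using dd by (simp add: power2_diff)
        then show ?thesis using r by (simp add: power_divide add_divide_distrib[symmetric])
      qed
      then obtain \<theta> where \<theta>: "(r - norm p) / r = cos \<theta>" "(d \<bullet> \<tau>) / r = sin \<theta>"
        using sincos_total_2pi by metis
      have "\<sigma> (r * \<theta>) = \<gamma> x + r *\<^sub>R n + r *\<^sub>R (- (((r - norm p) / r) *\<^sub>R n) + ((d \<bullet> \<tau>) / r) *\<^sub>R \<tau>)"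
        using r \<theta> by (simp add: \<sigma>_def)
      also have "\<dots> = \<gamma> x + norm p *\<^sub>R n + (d \<bullet> \<tau>) *\<^sub>R \<tau>"
        unfolding scaleR_add_right scaleR_minus_right scaleR_scaleR
        using r by (simp add: scaleR_diff_left)
      also have "\<dots> = \<gamma> x + d"
      proof -
        have "norm p *\<^sub>R n = p" using \<open>p \<noteq> 0\<close> by (simp add: n_def)
        then show ?thesis by (simp only: p) simp
      qed
      finally have "y = \<sigma> (r * \<theta>)" by (simp add: d_def)
      then show "\<exists>\<sigma>. tangent_circle \<gamma> x \<sigma> \<and> y \<in> range \<sigma> \<and> k = curvature_vector \<sigma> 0"
        using tang kn by blast
    next
      fix k' assume "\<exists>\<sigma>. tangent_circle \<gamma> x \<sigma> \<and> y \<in> range \<sigma> \<and> k' = curvature_vector \<sigma> 0"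
      then obtain \<sigma> s where \<sigma>: "tangent_circle \<gamma> x \<sigma>" "y = \<sigma> s" "k' = curvature_vector \<sigma> 0" by blast
      from \<sigma>(1) obtain c r u v where r: "0 < r" and n: "norm u = 1" "norm v = 1" and uv: "u \<bullet> v = 0"
        and \<sigma>eq: "\<sigma> = (\<lambda>s. c + r *\<^sub>R (cos (s / r) *\<^sub>R u + sin (s / r) *\<^sub>R v))"
        and s0: "\<sigma> 0 = \<gamma> x" and s1: "vderiv \<sigma> 0 = \<tau>"
        unfolding tangent_circle_def arc_length_circle_def \<tau>_def by blast
      have "vderiv \<sigma> 0 = v" unfolding \<sigma>eq by (subst vderiv_circle) (use r in auto)
      then have v: "v = \<tau>" using s1 by simp
      have k': "k' = - (1 / r) *\<^sub>R u"
        unfolding \<sigma>(3) \<sigma>eq by (rule curvature_vector_circle) (use r in auto)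
      define C S where "C = cos (s / r)" and "S = sin (s / r)"
      have d: "d = (r * (C - 1)) *\<^sub>R u + (r * S) *\<^sub>R v"
      proof -
        have "d = \<sigma> s - \<sigma> 0" by (simp add: d_def \<sigma>(2) s0)
        then show ?thesis unfolding \<sigma>eq by (simp add: C_def S_def algebra_simps)
      qed
      have uu: "u \<bullet> u = 1" "v \<bullet> v = 1" using n by (simp_all add: norm_eq_1)
      have vu: "v \<bullet> u = 0" using uv by (simp add: inner_commute)
      have pu: "p = (r * (C - 1)) *\<^sub>R u"
        unfolding p v[symmetric] d by (simp add: inner_add_left uv uu)
      have CS: "C\<^sup>2 + S\<^sup>2 = 1" by (simp add: C_def S_def)
      have "(norm d)\<^sup>2 = (r * (C - 1))\<^sup>2 + (r * S)\<^sup>2"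
        unfolding power2_norm_eq_inner d
        by (simp add: inner_add_left inner_add_right uv vu uu power2_eq_square)
      also have "\<dots> = r\<^sup>2 * ((C\<^sup>2 + S\<^sup>2) + 1 - 2 * C)"
        by (simp add: power2_eq_square algebra_simps)
      also have "\<dots> = 2 * r\<^sup>2 * (1 - C)" unfolding CS by (simp add: algebra_simps)
      finally have nd: "(norm d)\<^sup>2 = 2 * r\<^sup>2 * (1 - C)" .
      then have "C \<noteq> 1" using \<open>d \<noteq> 0\<close> by auto
      have "(2 / (norm d)\<^sup>2) * (r * (C - 1)) = - (1 / r)"
      proof -
        define D where "D = 1 - C"
        have "D \<noteq> 0" "C - 1 = - D" using \<open>C \<noteq> 1\<close> by (simp_all add: D_def)
        then show ?thesis unfolding nd D_def[symmetric] using r by (simp add: power2_eq_square)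
      qed
      then show "k' = k" by (simp add: k_def pu k')
    qed
    then show ?thesis using False by (simp add: circle_curvature_def k_def p_def d_def \<tau>_def)
  qed
qed

section \<open>Behaviour of the integrand near the base point\<close>

lemma smooth_has_vector_derivative:
  assumes "smooth f"
  shows "((vderiv ^^ k) f has_vector_derivative (vderiv ^^ Suc k) f t) (at t)"
proof -
  have "(vderiv ^^ k) f differentiable (at t)" using assms by (simp add: smooth_def)
  then show ?thesis by (simp add: vderiv_def flip: vector_derivative_works)
qed

lemma has_vector_derivative_shift:
  assumes "(f has_vector_derivative f') (at (x + w))"
  shows "((\<lambda>w. f (x + w)) has_vector_derivative f') (at w)"
proof -
  have "((\<lambda>w. x + w) has_vector_derivative 0 + 1) (at w)"
    by (intro has_vector_derivative_add has_vector_derivative_const has_vector_derivative_id)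
  from vector_diff_chain_at[OF this, of f f'] assms show ?thesis by (simp add: o_def)
qed

lemma vector_derivative_power_growth:
  fixes f :: "real \<Rightarrow> 'a::real_normed_vector"
  assumes f0: "f 0 = 0" and f': "\<And>t. (f has_vector_derivative f' t) (at t)"
    and bound: "\<And>t. \<bar>t\<bar> \<le> b \<Longrightarrow> norm (f' t) \<le> M * \<bar>t\<bar> ^ m" and "M \<ge> 0" "\<bar>w\<bar> \<le> b"
  shows "norm (f w) \<le> M * \<bar>w\<bar> ^ Suc m"
proof -
  have "norm (f w - f 0) \<le> (M * \<bar>w\<bar> ^ m) * norm (w - 0)"
  proof (rule differentiable_bound[of "{- \<bar>w\<bar>..\<bar>w\<bar>}"])
    fix t assume t: "t \<in> {- \<bar>w\<bar>..\<bar>w\<bar>}"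
    show "(f has_derivative (\<lambda>h. h *\<^sub>R f' t)) (at t within {- \<bar>w\<bar>..\<bar>w\<bar>})"
      using f'[of t] by (simp add: has_vector_derivative_def has_derivative_at_withinI)
    have "norm (f' t) \<le> M * \<bar>t\<bar> ^ m" using t \<open>\<bar>w\<bar> \<le> b\<close> by (intro bound) auto
    also have "\<dots> \<le> M * \<bar>w\<bar> ^ m" using t \<open>M \<ge> 0\<close> by (intro mult_left_mono power_mono) auto
    finally show "onorm (\<lambda>h. h *\<^sub>R f' t) \<le> M * \<bar>w\<bar> ^ m"
      by (intro onorm_le) (simp add: mult.commute mult_left_mono)
  qed auto
  then show ?thesis by (simp add: f0 mult_ac)
qed

text \<open>
  The third derivative is bounded on a compact interval; this bound is integrated three times.
\<close>

lemma second_order_taylor_bound: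
  fixes \<gamma> :: "real \<Rightarrow> 'a::real_normed_vector"
  assumes sm: "smooth \<gamma>"
  shows "\<exists>M\<ge>0. \<forall>w. \<bar>w\<bar> \<le> 1 \<longrightarrow>
    norm (\<gamma> (x + w) - \<gamma> x - w *\<^sub>R vderiv \<gamma> x - (w\<^sup>2 / 2) *\<^sub>R vderiv (vderiv \<gamma>) x) \<le> M * \<bar>w\<bar> ^ 3"
proof -
  let ?D = "\<lambda>k. (vderiv ^^ k) \<gamma>"
  have shift: "((\<lambda>w. ?D k (x + w)) has_vector_derivative ?D (Suc k) (x + w)) (at w)" for k w
    using smooth_has_vector_derivative[OF sm] by (rule has_vector_derivative_shift)
  have "continuous_on {-1..1} (\<lambda>w. ?D 3 (x + w))"
    by (intro continuous_at_imp_continuous_on ballI has_vector_derivative_continuous[OF shift])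
  then have "bounded ((\<lambda>w. ?D 3 (x + w)) ` {-1..1})"
    by (intro compact_imp_bounded compact_continuous_image) auto
  then obtain M where M: "M > 0" "\<And>w. w \<in> {-1..1} \<Longrightarrow> norm (?D 3 (x + w)) \<le> M"
    unfolding bounded_pos by auto
  have M': "norm (?D 3 (x + w)) \<le> M" if "\<bar>w\<bar> \<le> 1" for w
    using M(2)[of w] that by (simp add: abs_le_iff)
  have 2: "norm (?D 2 (x + w) - ?D 2 x) \<le> M * \<bar>w\<bar> ^ Suc 0" if "\<bar>w\<bar> \<le> 1" for w
    by (rule vector_derivative_power_growth[where b=1 and f'="\<lambda>w. ?D 3 (x + w)"])
      (use M(1) M' that shift[of 2] in \<open>auto intro!: derivative_eq_intros simp: numeral_3_eq_3 numeral_2_eq_2\<close>)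
  have 1: "norm (?D 1 (x + w) - ?D 1 x - w *\<^sub>R ?D 2 x) \<le> M * \<bar>w\<bar> ^ Suc (Suc 0)" if "\<bar>w\<bar> \<le> 1" for w
    by (rule vector_derivative_power_growth[where b=1 and f'="\<lambda>w. ?D 2 (x + w) - ?D 2 x"])
      (use M(1) that 2 shift[of 1] in \<open>auto intro!: derivative_eq_intros simp: numeral_2_eq_2\<close>)
  have "norm (?D 0 (x + w) - ?D 0 x - w *\<^sub>R ?D 1 x - (w\<^sup>2 / 2) *\<^sub>R ?D 2 x) \<le> M * \<bar>w\<bar> ^ Suc (Suc (Suc 0))"
    if "\<bar>w\<bar> \<le> 1" for w
    by (rule vector_derivative_power_growth[where b=1 and f'="\<lambda>w. ?D 1 (x + w) - ?D 1 x - w *\<^sub>R ?D 2 x"])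
      (use M(1) that 1 shift[of 0] in \<open>auto intro!: derivative_eq_intros\<close>)
  then show ?thesis using M(1) by (intro exI[of _ M]) (auto simp: numeral_2_eq_2 numeral_3_eq_3)
qed

lemma velocity_orthogonal_curvature:
  fixes \<gamma> :: "real \<Rightarrow> 'a::real_inner"
  assumes sm: "smooth \<gamma>" and unit: "\<And>t. norm (vderiv \<gamma> t) = 1"
  shows "vderiv (vderiv \<gamma>) x \<bullet> vderiv \<gamma> x = 0"
proof -
  have "(vderiv \<gamma> has_vector_derivative vderiv (vderiv \<gamma>) x) (at x)"
    using smooth_has_vector_derivative[OF sm, of 1 x] by simp
  then have "((\<lambda>t. vderiv \<gamma> t \<bullet> vderiv \<gamma> t) has_vector_derivative
      vderiv \<gamma> x \<bullet> vderiv (vderiv \<gamma>) x + vderiv (vderiv \<gamma>) x \<bullet> vderiv \<gamma> x) (at x)"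
    by (intro bounded_bilinear.has_vector_derivative[OF bounded_bilinear_inner])
  moreover have "(\<lambda>t. vderiv \<gamma> t \<bullet> vderiv \<gamma> t) = (\<lambda>t. 1)" using unit by (simp add: norm_eq_1)
  ultimately have "vderiv \<gamma> x \<bullet> vderiv (vderiv \<gamma>) x + vderiv (vderiv \<gamma>) x \<bullet> vderiv \<gamma> x = 0"
    using vector_derivative_unique_at[OF _ has_vector_derivative_const] by metis
  then show ?thesis by (simp add: inner_commute)
qed

lemma norm_perp_proj_le:
  assumes "norm \<tau> = 1"
  shows "norm (perp_proj \<tau> d) \<le> norm d"
proof -
  have t: "\<tau> \<bullet> \<tau> = 1" using assms by (simp add: norm_eq_1)
  have "(norm (perp_proj \<tau> d))\<^sup>2 = (norm d)\<^sup>2 - (d \<bullet> \<tau>)\<^sup>2"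
    unfolding perp_proj_def power2_norm_eq_inner t
    by (simp add: inner_diff_left inner_diff_right t inner_commute[of \<tau> d] power2_eq_square)
  then have "(norm (perp_proj \<tau> d))\<^sup>2 \<le> (norm d)\<^sup>2" by simp
  then show ?thesis by (rule power2_le_imp_le) simp
qed

text \<open>
  Write \<open>d = \<gamma> (x + w) - \<gamma> x = w \<tau> + (w\<^sup>2/2) \<kappa> + e\<close> with \<open>|e| = O(|w|\<^sup>3)\<close>. The linear term shows that
  \<open>|d|\<close> is \<open>|w|\<close> up to \<open>K w\<^sup>2\<close>. As \<open>\<tau>\<close> and \<open>\<kappa>\<close> are orthogonal, \<open>2 P\<^sup>\<bottom> d = w\<^sup>2 \<kappa> + 2 P\<^sup>\<bottom> e\<close>, so in
  \<open>2 P\<^sup>\<bottom> d - |d|\<^sup>2 \<kappa>\<close> the quadratic terms cancel up to \<open>O(|w|\<^sup>3)\<close>; division by \<open>|d|\<^sup>4\<close>, which is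
  comparable to \<open>w\<^sup>4\<close>, leaves \<open>O(1/|w|)\<close>.
\<close>

lemma chord_and_H_integrand_bounds:
  fixes \<gamma> :: "real \<Rightarrow> 'a::euclidean_space"
  assumes sm: "smooth \<gamma>" and unit: "\<And>t. norm (vderiv \<gamma> t) = 1"
  shows "\<exists>K>0. \<exists>C\<ge>0. \<exists>r>0. \<forall>w. 0 < \<bar>w\<bar> \<longrightarrow> \<bar>w\<bar> \<le> r \<longrightarrow>
      K * \<bar>w\<bar> \<le> 1 / 2 \<and> \<bar>w\<bar> - K * w\<^sup>2 \<le> norm (\<gamma> (x + w) - \<gamma> x) \<and>
      norm (H_integrand \<gamma> x w) \<le> C / \<bar>w\<bar>"
proof -
  interpret unit_speed_curve \<gamma> "vderiv \<gamma>"
    using smooth_has_vector_derivative[OF sm, of 0] smooth_has_vector_derivative[OF sm, of 1] unit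
    by unfold_locales (auto intro!: continuous_at_imp_continuous_on has_vector_derivative_continuous)
  define \<tau> \<kappa> where "\<tau> = vderiv \<gamma> x" and "\<kappa> = vderiv (vderiv \<gamma>) x"
  have tt: "\<tau> \<bullet> \<tau> = 1" "norm \<tau> = 1" using unit[of x] by (simp_all add: \<tau>_def norm_eq_1)
  have tk: "\<kappa> \<bullet> \<tau> = 0" unfolding \<tau>_def \<kappa>_def by (rule velocity_orthogonal_curvature[OF sm unit])
  obtain M where M: "M \<ge> 0" "\<And>w. \<bar>w\<bar> \<le> 1 \<Longrightarrow>
      norm (\<gamma> (x + w) - \<gamma> x - w *\<^sub>R \<tau> - (w\<^sup>2 / 2) *\<^sub>R \<kappa>) \<le> M * \<bar>w\<bar> ^ 3"
    using second_order_taylor_bound[OF sm, of x] unfolding \<tau>_def \<kappa>_def by blast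
  \<comment> \<open>The summand \<open>1\<close> only makes \<open>K\<close> positive; the factor \<open>16\<close> comes from \<open>|d| \<ge> |w|/2\<close>, raised to the fourth power.\<close>
  define K where "K = norm \<kappa> / 2 + M + 1"
  define C where "C = 16 * (2 * M + 2 * K * norm \<kappa>)"
  define r where "r = min 1 (1 / (2 * K))"
  have K: "K > 0" using M by (simp add: K_def add_nonneg_pos)
  have "C \<ge> 0" using M K by (simp add: C_def)
  have "r > 0" using K by (simp add: r_def)
  have main: "K * \<bar>w\<bar> \<le> 1 / 2 \<and> \<bar>w\<bar> - K * w\<^sup>2 \<le> norm (\<gamma> (x + w) - \<gamma> x) \<and>
      norm (H_integrand \<gamma> x w) \<le> C / \<bar>w\<bar>" if w: "0 < \<bar>w\<bar>" "\<bar>w\<bar> \<le> r" for w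
  proof (intro conjI)
    define d where "d = \<gamma> (x + w) - \<gamma> x"
    define e where "e = d - w *\<^sub>R \<tau> - (w\<^sup>2 / 2) *\<^sub>R \<kappa>"
    have w1: "\<bar>w\<bar> \<le> 1" using w by (simp add: r_def)
    have "\<bar>w\<bar> \<le> 1 / (2 * K)" using w by (simp add: r_def)
    then show Kw: "K * \<bar>w\<bar> \<le> 1 / 2" using K by (simp add: field_simps)
    have e: "norm e \<le> M * \<bar>w\<bar> ^ 3" using M(2)[OF w1] by (simp add: e_def d_def)
    have w3: "\<bar>w\<bar> ^ 3 = w\<^sup>2 * \<bar>w\<bar>" by (simp add: power3_eq_cube power2_eq_square)
    have "M * (w\<^sup>2 * \<bar>w\<bar>) \<le> M * (w\<^sup>2 * 1)" using M(1) w1 by (intro mult_left_mono) auto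
    then have e2: "norm e \<le> M * w\<^sup>2" using e w3 by simp
    have "\<bar>w\<bar> = norm (w *\<^sub>R \<tau>)" by (simp add: tt)
    also have "w *\<^sub>R \<tau> = d - e - (w\<^sup>2 / 2) *\<^sub>R \<kappa>" by (simp add: e_def)
    also have "norm (d - e - (w\<^sup>2 / 2) *\<^sub>R \<kappa>) \<le> norm d + norm e + norm ((w\<^sup>2 / 2) *\<^sub>R \<kappa>)"
      by (metis add_right_mono norm_triangle_ineq4 order_trans)
    also have "\<dots> \<le> norm d + K * w\<^sup>2"
      using e2 by (simp add: K_def algebra_simps add_increasing)
    finally show low: "\<bar>w\<bar> - K * w\<^sup>2 \<le> norm (\<gamma> (x + w) - \<gamma> x)" by (simp add: d_def)
    have up: "norm d \<le> \<bar>w\<bar>" using norm_diff_le[of "x + w" x] by (simp add: d_def)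
    have half: "\<bar>w\<bar> / 2 \<le> norm d"
    proof -
      have "K * w\<^sup>2 = (K * \<bar>w\<bar>) * \<bar>w\<bar>" by (simp add: power2_eq_square)
      also have "\<dots> \<le> (1 / 2) * \<bar>w\<bar>" using Kw by (intro mult_right_mono) auto
      finally show ?thesis using low by (simp add: d_def)
    qed
    then have dpos: "norm d > 0" using w by linarith
    have perp: "2 *\<^sub>R perp_proj \<tau> d = w\<^sup>2 *\<^sub>R \<kappa> + 2 *\<^sub>R perp_proj \<tau> e"
      unfolding perp_proj_def e_def tt
      by (simp add: inner_diff_left tk tt algebra_simps)
    have diff: "0 \<le> w\<^sup>2 - (norm d)\<^sup>2" "w\<^sup>2 - (norm d)\<^sup>2 \<le> 2 * K * \<bar>w\<bar> ^ 3"
    proof -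
      show "0 \<le> w\<^sup>2 - (norm d)\<^sup>2" using power_mono[OF up, of 2] by simp
      have "w\<^sup>2 - (norm d)\<^sup>2 = (\<bar>w\<bar> - norm d) * (\<bar>w\<bar> + norm d)"
        by (simp add: power2_eq_square algebra_simps)
      also have "\<dots> \<le> (K * w\<^sup>2) * (2 * \<bar>w\<bar>)"
        using low up K by (intro mult_mono) (auto simp: d_def)
      finally show "w\<^sup>2 - (norm d)\<^sup>2 \<le> 2 * K * \<bar>w\<bar> ^ 3" by (simp add: w3)
    qed
    have num: "norm (2 *\<^sub>R perp_proj \<tau> d - (norm d)\<^sup>2 *\<^sub>R \<kappa>) \<le> (2 * M + 2 * K * norm \<kappa>) * \<bar>w\<bar> ^ 3"
    proof -
      have "2 *\<^sub>R perp_proj \<tau> d - (norm d)\<^sup>2 *\<^sub>R \<kappa> = 2 *\<^sub>R perp_proj \<tau> e + (w\<^sup>2 - (norm d)\<^sup>2) *\<^sub>R \<kappa>"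
        unfolding perp by (simp add: algebra_simps)
      also have "norm \<dots> \<le> 2 * norm (perp_proj \<tau> e) + (w\<^sup>2 - (norm d)\<^sup>2) * norm \<kappa>"
        using diff(1) norm_triangle_ineq[of "2 *\<^sub>R perp_proj \<tau> e" "(w\<^sup>2 - (norm d)\<^sup>2) *\<^sub>R \<kappa>"] by simp
      also have "\<dots> \<le> 2 * (M * \<bar>w\<bar> ^ 3) + (2 * K * \<bar>w\<bar> ^ 3) * norm \<kappa>"
        using norm_perp_proj_le[OF tt(2), of e] e diff(2)
        by (intro add_mono mult_left_mono mult_right_mono) auto
      finally show ?thesis by (simp add: algebra_simps)
    qed
    have "H_integrand \<gamma> x w = (1 / norm d ^ 4) *\<^sub>R (2 *\<^sub>R perp_proj \<tau> d - (norm d)\<^sup>2 *\<^sub>R \<kappa>)"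
      using dpos unfolding H_integrand_def d_def[symmetric] \<tau>_def[symmetric] \<kappa>_def[symmetric]
      by (simp add: scaleR_diff_right power2_eq_square power4_eq_xxxx)
    then have "norm (H_integrand \<gamma> x w) = norm (2 *\<^sub>R perp_proj \<tau> d - (norm d)\<^sup>2 *\<^sub>R \<kappa>) / norm d ^ 4"
      by simp
    also have "\<dots> \<le> ((2 * M + 2 * K * norm \<kappa>) * \<bar>w\<bar> ^ 3) / (\<bar>w\<bar> / 2) ^ 4"
      using num half w M K by (intro frac_le power_mono) auto
    also have "\<dots> = C / \<bar>w\<bar>"
      using w by (simp add: C_def field_simps power_numeral_reduce)
    finally show "norm (H_integrand \<gamma> x w) \<le> C / \<bar>w\<bar>" .
  qed
  show ?thesis using K \<open>C \<ge> 0\<close> \<open>r > 0\<close> main by blast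
qed

section \<open>Comparison of the two cutoffs\<close>

text \<open>
  In the application \<open>\<rho> w\<close> is the length of the chord with offset \<open>w\<close>. The domains \<open>A J \<epsilon>\<close> and
  \<open>B J \<epsilon>\<close> are cofinal by the assumptions \<open>le\<close> and \<open>sep\<close>. For small \<open>\<epsilon>\<close>, an offset in their
  difference satisfies \<open>\<rho> w < \<epsilon> \<le> |w| < r\<close>, so \<open>near\<close> confines \<open>|w|\<close> to \<open>[\<epsilon>, \<epsilon> + 4 K \<epsilon>\<^sup>2]\<close>; with the
  integrand bounded by \<open>C/\<epsilon>\<close> there, the integrals differ by \<open>O(\<epsilon>)\<close>.
\<close>

lemma principal_value_cutoffs:
  fixes h :: "real \<Rightarrow> 'a::{banach, second_countable_topology}" and \<rho> :: "real \<Rightarrow> real"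
  defines "A \<equiv> \<lambda>J \<epsilon>. {w \<in> J. \<epsilon> \<le> \<bar>w\<bar>}" and "B \<equiv> \<lambda>J \<epsilon>. {w \<in> J. \<epsilon> \<le> \<rho> w}"
  assumes J: "J \<in> sets borel" and \<rho>: "\<rho> \<in> borel_measurable borel"
    and le: "\<And>w. \<rho> w \<le> \<bar>w\<bar>"
    and sep: "\<And>\<delta>. \<delta> > 0 \<Longrightarrow> \<exists>\<eta>>0. \<forall>w\<in>J. \<rho> w < \<eta> \<longrightarrow> \<bar>w\<bar> < \<delta>"
    and "K > 0" "C \<ge> 0" "r > 0"
    and near: "\<And>w. 0 < \<bar>w\<bar> \<Longrightarrow> \<bar>w\<bar> \<le> r \<Longrightarrow>
        K * \<bar>w\<bar> \<le> 1 / 2 \<and> \<bar>w\<bar> - K * w\<^sup>2 \<le> \<rho> w \<and> norm (h w) \<le> C / \<bar>w\<bar>"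
  shows "(\<forall>\<epsilon>>0. set_integrable lborel (A J \<epsilon>) h) \<longleftrightarrow> (\<forall>\<epsilon>>0. set_integrable lborel (B J \<epsilon>) h)"
    and "\<forall>\<epsilon>>0. set_integrable lborel (A J \<epsilon>) h \<Longrightarrow>
      ((\<lambda>\<epsilon>. (LINT w:A J \<epsilon>|lborel. h w) - (LINT w:B J \<epsilon>|lborel. h w)) \<longlongrightarrow> 0) (at_right 0)"
proof -
  have meas: "A J \<epsilon> \<in> sets lborel" "B J \<epsilon> \<in> sets lborel" for \<epsilon>
  proof -
    have "A J \<epsilon> = J \<inter> {w \<in> space borel. \<epsilon> \<le> \<bar>w\<bar>}" "B J \<epsilon> = J \<inter> {w \<in> space borel. \<epsilon> \<le> \<rho> w}"
      by (auto simp: A_def B_def)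
    moreover have "{w \<in> space borel. \<epsilon> \<le> \<bar>w\<bar>} \<in> sets borel" "{w \<in> space borel. \<epsilon> \<le> \<rho> w} \<in> sets borel"
      using \<rho> by measurable
    ultimately show "A J \<epsilon> \<in> sets lborel" "B J \<epsilon> \<in> sets lborel" using J by auto
  qed
  have sub: "B J \<epsilon> \<subseteq> A J \<epsilon>" for \<epsilon> unfolding A_def B_def using le order_trans by blast
  show "(\<forall>\<epsilon>>0. set_integrable lborel (A J \<epsilon>) h) \<longleftrightarrow> (\<forall>\<epsilon>>0. set_integrable lborel (B J \<epsilon>) h)"
  proof (intro iffI allI impI)
    fix \<epsilon> :: real assume "\<forall>\<epsilon>>0. set_integrable lborel (A J \<epsilon>) h" "\<epsilon> > 0"
    then show "set_integrable lborel (B J \<epsilon>) h" using set_integrable_subset[OF _ meas(2) sub] by blast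
  next
    fix \<epsilon> :: real assume *: "\<forall>\<epsilon>>0. set_integrable lborel (B J \<epsilon>) h" and "\<epsilon> > 0"
    obtain \<eta> where \<eta>: "\<eta> > 0" "\<And>w. w \<in> J \<Longrightarrow> \<rho> w < \<eta> \<Longrightarrow> \<bar>w\<bar> < \<epsilon>" using sep[OF \<open>\<epsilon> > 0\<close>] by blast
    have "A J \<epsilon> \<subseteq> B J \<eta>" unfolding A_def B_def using \<eta>(2) by force
    then show "set_integrable lborel (A J \<epsilon>) h"
      using set_integrable_subset[OF _ meas(1)] * \<eta>(1) by blast
  qed
  assume int: "\<forall>\<epsilon>>0. set_integrable lborel (A J \<epsilon>) h"
  obtain \<eta> where \<eta>: "\<eta> > 0" "\<And>w. w \<in> J \<Longrightarrow> \<rho> w < \<eta> \<Longrightarrow> \<bar>w\<bar> < r" using sep[OF \<open>r > 0\<close>] by blast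
  have bound: "norm ((LINT w:A J \<epsilon>|lborel. h w) - (LINT w:B J \<epsilon>|lborel. h w)) \<le> 8 * K * C * \<epsilon>"
    if \<epsilon>: "0 < \<epsilon>" "\<epsilon> < \<eta>" for \<epsilon>
  proof -
    define b where "b = \<epsilon> + 4 * K * \<epsilon>\<^sup>2"
    define Z where "Z = {\<epsilon>..b} \<union> {-b..-\<epsilon>}"
    let ?E = "A J \<epsilon> - B J \<epsilon>"
    have "\<epsilon> \<le> b" using \<open>K > 0\<close> by (simp add: b_def)
    have E: "w \<in> Z \<and> norm (h w) \<le> C / \<epsilon>" if "w \<in> ?E" for w
    proof -
      have w: "\<epsilon> \<le> \<bar>w\<bar>" "\<rho> w < \<epsilon>" "w \<in> J" using that by (auto simp: A_def B_def)
      have "\<bar>w\<bar> < r" using \<eta>(2)[of w] w \<epsilon> by linarith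
      then have n: "K * \<bar>w\<bar> \<le> 1 / 2" "\<bar>w\<bar> - K * w\<^sup>2 \<le> \<rho> w" "norm (h w) \<le> C / \<bar>w\<bar>"
        using near[of w] w \<epsilon> by auto
      have Kw: "K * w\<^sup>2 \<le> \<bar>w\<bar> / 2"
        using mult_right_mono[OF n(1), of "\<bar>w\<bar>"] by (simp add: power2_eq_square)
      then have "\<bar>w\<bar> \<le> 2 * \<epsilon>" using n(2) w(2) by linarith
      then have "\<bar>w\<bar>\<^sup>2 \<le> (2 * \<epsilon>)\<^sup>2" by (intro power_mono) auto
      then have "K * w\<^sup>2 \<le> K * (4 * \<epsilon>\<^sup>2)"
        using \<open>K > 0\<close> by (intro mult_left_mono) (auto simp: power_mult_distrib)
      then have "\<bar>w\<bar> \<le> b" using n(2) w(2) by (simp add: b_def)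
      then have "w \<in> Z" using w(1) by (auto simp: Z_def abs_real_def split: if_splits)
      moreover have "C / \<bar>w\<bar> \<le> C / \<epsilon>" using w(1) \<epsilon> \<open>C \<ge> 0\<close> by (intro divide_left_mono) auto
      ultimately show ?thesis using n(3) by auto
    qed
    have intE: "set_integrable lborel ?E h"
      by (rule set_integrable_subset[of _ "A J \<epsilon>"]) (use int \<epsilon> meas in auto)
    have intB: "set_integrable lborel (B J \<epsilon>) h"
      by (rule set_integrable_subset[OF _ meas(2) sub]) (use int \<epsilon> in auto)
    have "A J \<epsilon> = ?E \<union> B J \<epsilon>" using sub by blast
    then have "(LINT w:A J \<epsilon>|lborel. h w) = (LINT w:?E|lborel. h w) + (LINT w:B J \<epsilon>|lborel. h w)"
      using set_integral_Un[OF _ intE intB] by auto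
    then have "norm ((LINT w:A J \<epsilon>|lborel. h w) - (LINT w:B J \<epsilon>|lborel. h w)) = norm (LINT w:?E|lborel. h w)"
      by simp
    also have "\<dots> \<le> (LINT w|lborel. indicator Z w * (C / \<epsilon>))"
      unfolding set_lebesgue_integral_def
    proof (rule Bochner_Integration.integral_norm_bound_integral)
      show "integrable lborel (\<lambda>w. indicator ?E w *\<^sub>R h w)" using intE by (simp add: set_integrable_def)
      show "integrable lborel (\<lambda>w. indicat_real Z w * (C / \<epsilon>))"
      proof (intro integrable_mult_left integrable_real_indicator)
        show "emeasure lborel Z < \<infinity>" unfolding Z_def by (rule emeasure_bounded_finite) auto
      qed (simp add: Z_def)
      fix w
      show "norm (indicat_real ?E w *\<^sub>R h w) \<le> indicat_real Z w * (C / \<epsilon>)"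
        using E[of w] \<epsilon> \<open>C \<ge> 0\<close> by (auto simp: indicator_def)
    qed
    also have "\<dots> = measure lborel Z * (C / \<epsilon>)" by simp
    also have "\<dots> \<le> (2 * (b - \<epsilon>)) * (C / \<epsilon>)"
    proof (rule mult_right_mono)
      have "measure lborel Z \<le> measure lborel {\<epsilon>..b} + measure lborel {-b..-\<epsilon>}"
        unfolding Z_def by (rule measure_Un_le) auto
      then show "measure lborel Z \<le> 2 * (b - \<epsilon>)" using \<open>\<epsilon> \<le> b\<close> by simp
    qed (use \<open>C \<ge> 0\<close> \<epsilon> in auto)
    also have "\<dots> = 8 * K * C * \<epsilon>" using \<epsilon> by (simp add: b_def power2_eq_square)
    finally show ?thesis .
  qed
  show "((\<lambda>\<epsilon>. (LINT w:A J \<epsilon>|lborel. h w) - (LINT w:B J \<epsilon>|lborel. h w)) \<longlongrightarrow> 0) (at_right 0)"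
  proof (rule Lim_null_comparison)
    show "\<forall>\<^sub>F \<epsilon> in at_right 0. norm ((LINT w:A J \<epsilon>|lborel. h w) - (LINT w:B J \<epsilon>|lborel. h w)) \<le> 8 * K * C * \<epsilon>"
      using bound \<eta>(1) by (auto simp: eventually_at_right_field)
    have "((\<lambda>\<epsilon>. 8 * K * C * \<epsilon>) \<longlongrightarrow> 8 * K * C * 0) (at_right 0)"
      by (intro tendsto_intros)
    then show "((\<lambda>\<epsilon>. 8 * K * C * \<epsilon>) \<longlongrightarrow> 0) (at_right 0)" by simp
  qed
qed

section \<open>The parameter domain of an embedded curve\<close>

text \<open>
  The image of a small parameter ball around \<open>x\<close> is open in \<open>\<Gamma>\<close>, hence contains every curve point
  close to \<open>\<gamma> x\<close>. In the periodic case this locates \<open>x + w\<close> only up to a multiple of \<open>l\<close>; the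
  bound \<open>d \<le> l/2\<close> on the radius of the ball forces that multiple to be \<open>0\<close>.
\<close>

lemma embedded_curve_separation:
  fixes \<gamma> :: "real \<Rightarrow> 'a::real_normed_vector"
  assumes I: "I = Real_Line \<or> (\<exists>l>0. I = Real_Mod l)"
    and emb: "smooth_embedded_curve I \<gamma>" and "\<delta> > 0"
  shows "\<exists>\<eta>>0. \<forall>w\<in>offset_range I. norm (\<gamma> (x + w) - \<gamma> x) < \<eta> \<longrightarrow> \<bar>w\<bar> < \<delta>"
proof -
  obtain d where d: "0 < d" "d \<le> \<delta>" "\<And>l. I = Real_Mod l \<Longrightarrow> d \<le> l / 2"
    using I \<open>\<delta> > 0\<close>
  proof (elim disjE exE conjE)
    fix l assume "l > 0" "I = Real_Mod l"
    then show ?thesis using that[of "min \<delta> (l / 2)"] \<open>\<delta> > 0\<close> by auto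
  qed (use that[of \<delta>] in auto)
  have "openin (top_of_set (range \<gamma>)) (\<gamma> ` ball x d)"
    using emb unfolding smooth_embedded_curve_def open_map_def by simp
  then obtain \<eta> where \<eta>: "\<eta> > 0" "\<And>y. y \<in> range \<gamma> \<Longrightarrow> dist y (\<gamma> x) < \<eta> \<Longrightarrow> y \<in> \<gamma> ` ball x d"
    unfolding openin_euclidean_subtopology_iff using \<open>0 < d\<close> by (metis centre_in_ball imageI)
  show ?thesis
  proof (intro exI conjI ballI impI)
    fix w assume w: "w \<in> offset_range I" "norm (\<gamma> (x + w) - \<gamma> x) < \<eta>"
    then obtain t where t: "\<gamma> (x + w) = \<gamma> t" "\<bar>t - x\<bar> < d"
      using \<eta>(2)[of "\<gamma> (x + w)"] by (auto simp: dist_norm dist_real_def)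
    have same: "same_param I (x + w) t"
      using emb t(1) unfolding smooth_embedded_curve_def by blast
    have "x + w = t"
      using I
    proof (elim disjE exE conjE)
      fix l assume l: "l > 0" "I = Real_Mod l"
      then obtain k :: int where k: "x + w - t = of_int k * l" using same by auto
      have "\<bar>w\<bar> \<le> l / 2" using w(1) l by auto
      then have "\<bar>x + w - t\<bar> < l" using t(2) d(3)[OF l(2)] by linarith
      then have "\<bar>of_int k :: real\<bar> * l < 1 * l" using k l(1) by (simp add: abs_mult)
      then have "\<bar>of_int k :: real\<bar> < 1" using l(1) by (simp only: mult_less_cancel_right_pos)
      then have "k = 0" by linarith
      then show ?thesis using k by simp
    qed (use same in auto)
    then show "\<bar>w\<bar> < \<delta>" using t(2) d(2) by auto
  qed (rule \<eta>(1))
qed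

text \<open>
  The closed offset range of a periodic curve covers the point at distance half a period twice.
  Its interior \<open>D\<close> parameterizes the curve injectively and misses only that point;
  \<open>X\<close> is the set of its endpoints.
\<close>

lemma fundamental_interval:
  fixes \<gamma> :: "real \<Rightarrow> 'a::real_normed_vector"
  assumes I: "I = Real_Line \<or> (\<exists>l>0. I = Real_Mod l)"
    and emb: "smooth_embedded_curve I \<gamma>"
  obtains D X where "D = UNIV \<or> (\<exists>a b. D = {a<..<b})" "D \<subseteq> offset_range I" "finite X"
    "offset_range I - D \<subseteq> X" "inj_on (\<lambda>w. \<gamma> (x + w)) D"
    "range \<gamma> - (\<lambda>w. \<gamma> (x + w)) ` D \<subseteq> (\<lambda>w. \<gamma> (x + w)) ` X"
proof -
  have same: "\<gamma> s = \<gamma> t \<longleftrightarrow> same_param I s t" for s t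
    using emb by (simp add: smooth_embedded_curve_def)
  show thesis
    using I
  proof (elim disjE exE conjE)
    assume "I = Real_Line"
    then have "inj_on (\<lambda>w. \<gamma> (x + w)) UNIV" using same by (auto simp: inj_on_def)
    moreover have "range \<gamma> \<subseteq> range (\<lambda>w. \<gamma> (x + w))"
    proof clarify
      fix t
      have "\<gamma> t = \<gamma> (x + (t - x))" by simp
      then show "\<gamma> t \<in> range (\<lambda>w. \<gamma> (x + w))" by blast
    qed
    ultimately show thesis using that[of UNIV "{}"] \<open>I = Real_Line\<close> by auto
  next
    fix l assume l: "l > 0" "I = Real_Mod l"
    let ?D = "{- l / 2<..<l / 2}"
    show thesis
    proof (rule that[of ?D "{- l / 2, l / 2}"])
      show "inj_on (\<lambda>w. \<gamma> (x + w)) ?D"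
      proof (rule inj_onI)
        fix s t assume st: "s \<in> ?D" "t \<in> ?D" "\<gamma> (x + s) = \<gamma> (x + t)"
        then obtain k :: int where k: "s - t = of_int k * l" using same l by auto
        have "\<bar>s - t\<bar> < l" using st(1,2) by auto
        then have "\<bar>of_int k :: real\<bar> * l < 1 * l" using k l(1) by (simp add: abs_mult)
        then have "\<bar>of_int k :: real\<bar> < 1" using l(1) by (simp only: mult_less_cancel_right_pos)
        then have "k = 0" by linarith
        then show "s = t" using k by simp
      qed
      show "range \<gamma> - (\<lambda>w. \<gamma> (x + w)) ` ?D \<subseteq> (\<lambda>w. \<gamma> (x + w)) ` {- l / 2, l / 2}"
      proof clarify
        fix t assume nin: "\<gamma> t \<notin> (\<lambda>w. \<gamma> (x + w)) ` ?D"
        define k where "k = \<lfloor>(t - x) / l + 1 / 2\<rfloor>"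
        define w where "w = t - x - of_int k * l"
        have k: "of_int k \<le> (t - x) / l + 1 / 2" "(t - x) / l + 1 / 2 < of_int k + 1"
          by (simp_all add: k_def)
        have w: "- l / 2 \<le> w" "w < l / 2"
          using k l(1) by (simp_all add: w_def field_simps)
        have eq: "\<gamma> t = \<gamma> (x + w)" unfolding same l(2) by (auto simp: w_def)
        then have "w \<notin> ?D" using nin by blast
        then have "w = - l / 2" using w by auto
        then show "\<gamma> t \<in> (\<lambda>w. \<gamma> (x + w)) ` {- l / 2, l / 2}" using eq by blast
      qed
    qed (use l in auto)
  qed
qed

section \<open>Equivalence of the two principal values\<close>

lemma tendsto_zero_iff_of_diff:
  fixes f g :: "'a \<Rightarrow> 'b::real_normed_vector"
  assumes "((\<lambda>x. f x - g x) \<longlongrightarrow> 0) F"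
  shows "(f \<longlongrightarrow> 0) F \<longleftrightarrow> (g \<longlongrightarrow> 0) F"
proof
  assume "(f \<longlongrightarrow> 0) F"
  from tendsto_diff[OF this assms] show "(g \<longlongrightarrow> 0) F" by simp
next
  assume "(g \<longlongrightarrow> 0) F"
  from tendsto_add[OF this assms] show "(f \<longlongrightarrow> 0) F" by simp
qed

theorem lemma4p5:
  fixes I :: curve_domain and \<gamma> :: "real \<Rightarrow> real ^ 'n"
  assumes "I = Real_Line \<or> (\<exists>l>0. I = Real_Mod l)"
    and "smooth_embedded_curve I \<gamma>"
    and "arc_length_param \<gamma>"
  shows "(\<forall>x. has_H I \<gamma> x 0) \<longleftrightarrow>
    (\<forall>x.
      (\<forall>\<epsilon>>0. set_integrable hausdorff1 (range \<gamma> - ball (\<gamma> x) \<epsilon>)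
         (\<lambda>y. (1 / (norm (\<gamma> x - y))\<^sup>2) *\<^sub>R (circle_curvature \<gamma> x y - curvature_vector \<gamma> x))) \<and>
      ((\<lambda>\<epsilon>. LINT y:(range \<gamma> - ball (\<gamma> x) \<epsilon>)|hausdorff1.
         (1 / (norm (\<gamma> x - y))\<^sup>2) *\<^sub>R (circle_curvature \<gamma> x y - curvature_vector \<gamma> x))
        \<longlongrightarrow> 0) (at_right 0))"
proof (rule arg_cong[where f=All], rule ext)
  fix x
  have sm: "smooth \<gamma>" using assms(2) by (simp add: smooth_embedded_curve_def)
  have speed: "norm (vderiv \<gamma> t) = 1" for t using assms(3) by (simp add: arc_length_param_def)
  define c where "c = (\<lambda>w. \<gamma> (x + w))"
  interpret unit_speed_curve c "\<lambda>w. vderiv \<gamma> (x + w)"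
  proof
    show "(c has_vector_derivative vderiv \<gamma> (x + w)) (at w)" for w
      unfolding c_def using smooth_has_vector_derivative[OF sm, of 0]
      by (intro has_vector_derivative_shift) simp
    have "((\<lambda>w. vderiv \<gamma> (x + w)) has_vector_derivative vderiv (vderiv \<gamma>) (x + w)) (at w)" for w
      using smooth_has_vector_derivative[OF sm, of 1]
      by (intro has_vector_derivative_shift) simp
    then show "continuous_on UNIV (\<lambda>w. vderiv \<gamma> (x + w))"
      by (intro continuous_at_imp_continuous_on ballI has_vector_derivative_continuous)
  qed (rule speed)
  define F where "F y = (1 / (norm (\<gamma> x - y))\<^sup>2) *\<^sub>R (circle_curvature \<gamma> x y - curvature_vector \<gamma> x)" for y
  define h where "h = H_integrand \<gamma> x"
  define \<rho> where "\<rho> w = norm (\<gamma> (x + w) - \<gamma> x)" for w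
  define J where "J = offset_range I"
  have Feq: "F = (\<lambda>y. (1 / (norm (y - \<gamma> x))\<^sup>2) *\<^sub>R
      ((2 / (norm (y - \<gamma> x))\<^sup>2) *\<^sub>R perp_proj (vderiv \<gamma> x) (y - \<gamma> x) - vderiv (vderiv \<gamma>) x))"
    unfolding F_def circle_curvature_eq[OF speed] curvature_vector_def norm_minus_commute[of "\<gamma> x"] ..
  have hF: "h = (\<lambda>w. F (c w))" unfolding Feq h_def H_integrand_def c_def ..
  have Fmeas: "F \<in> borel_measurable borel" unfolding Feq perp_proj_def by measurable
  obtain D X where D: "D = UNIV \<or> (\<exists>a b. D = {a<..<b})" "D \<subseteq> J" "finite X" "J - D \<subseteq> X"
      "inj_on c D" "range \<gamma> - c ` D \<subseteq> c ` X"
    using fundamental_interval[OF assms(1,2), of x] unfolding J_def c_def by metis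
  have sub: "c ` D \<subseteq> range \<gamma>" by (auto simp: c_def)
  have Bset: "{w \<in> D. c w \<in> - ball (\<gamma> x) \<epsilon>} = {w \<in> D. \<epsilon> \<le> \<rho> w}" for \<epsilon>
    by (auto simp: \<rho>_def c_def dist_norm norm_minus_commute)
  have single: "emeasure hausdorff1 {p} = 0" for p :: "real ^ 'n"
    by (simp add: emeasure_hausdorff1 hausdorff1_outer_singleton)
  have transfer: "set_integrable hausdorff1 (range \<gamma> - ball (\<gamma> x) \<epsilon>) F
        \<longleftrightarrow> set_integrable lborel {w \<in> J. \<epsilon> \<le> \<rho> w} h"
    "(LINT y:(range \<gamma> - ball (\<gamma> x) \<epsilon>)|hausdorff1. F y) = (LINT w:{w \<in> J. \<epsilon> \<le> \<rho> w}|lborel. h w)" for \<epsilon>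
  proof -
    note tr = hausdorff1_image_transfer[OF D(1,5) Fmeas, of "- ball (\<gamma> x) \<epsilon>", unfolded Bset]
    have cnt: "countable (c ` X)" "countable X" using D(3) by (auto intro: countable_finite)
    have d1: "(range \<gamma> - ball (\<gamma> x) \<epsilon> - c ` D \<inter> - ball (\<gamma> x) \<epsilon>)
        \<union> (c ` D \<inter> - ball (\<gamma> x) \<epsilon> - (range \<gamma> - ball (\<gamma> x) \<epsilon>)) \<subseteq> c ` X"
      using D(6) sub by blast
    have d2: "({w \<in> J. \<epsilon> \<le> \<rho> w} - {w \<in> D. \<epsilon> \<le> \<rho> w}) \<union> ({w \<in> D. \<epsilon> \<le> \<rho> w} - {w \<in> J. \<epsilon> \<le> \<rho> w}) \<subseteq> X"
      using D(2,4) by blast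
    have "set_integrable hausdorff1 (range \<gamma> - ball (\<gamma> x) \<epsilon>) F
        \<longleftrightarrow> set_integrable hausdorff1 (c ` D \<inter> - ball (\<gamma> x) \<epsilon>) F"
      by (rule set_integrable_discrete_difference[OF cnt(1) d1]) (auto simp: single)
    also have "\<dots> \<longleftrightarrow> set_integrable lborel {w \<in> D. \<epsilon> \<le> \<rho> w} h"
      unfolding hF by (rule tr(1)) auto
    also have "\<dots> \<longleftrightarrow> set_integrable lborel {w \<in> J. \<epsilon> \<le> \<rho> w} h"
      by (rule set_integrable_discrete_difference[OF cnt(2) d2, symmetric]) auto
    finally show "set_integrable hausdorff1 (range \<gamma> - ball (\<gamma> x) \<epsilon>) F
        \<longleftrightarrow> set_integrable lborel {w \<in> J. \<epsilon> \<le> \<rho> w} h" .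
    have "(LINT y:(range \<gamma> - ball (\<gamma> x) \<epsilon>)|hausdorff1. F y)
        = (LINT y:c ` D \<inter> - ball (\<gamma> x) \<epsilon>|hausdorff1. F y)"
      by (rule set_integral_discrete_difference[OF cnt(1) d1]) (auto simp: single)
    also have "\<dots> = (LINT w:{w \<in> D. \<epsilon> \<le> \<rho> w}|lborel. h w)"
      unfolding hF by (rule tr(2)) auto
    also have "\<dots> = (LINT w:{w \<in> J. \<epsilon> \<le> \<rho> w}|lborel. h w)"
      by (rule set_integral_discrete_difference[OF cnt(2) d2, symmetric]) auto
    finally show "(LINT y:(range \<gamma> - ball (\<gamma> x) \<epsilon>)|hausdorff1. F y) = (LINT w:{w \<in> J. \<epsilon> \<le> \<rho> w}|lborel. h w)" .
  qed
  have Jbor: "J \<in> sets borel" using assms(1) by (auto simp: J_def)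
  have \<rho>meas: "\<rho> \<in> borel_measurable borel"
    using borel_measurable_curve unfolding \<rho>_def c_def by measurable
  have \<rho>le: "\<rho> w \<le> \<bar>w\<bar>" for w
    using norm_diff_le[of w 0] by (simp add: \<rho>_def c_def)
  obtain K C r where KCr: "K > 0" "C \<ge> 0" "r > 0" and near: "\<And>w. 0 < \<bar>w\<bar> \<Longrightarrow> \<bar>w\<bar> \<le> r \<Longrightarrow>
        K * \<bar>w\<bar> \<le> 1 / 2 \<and> \<bar>w\<bar> - K * w\<^sup>2 \<le> \<rho> w \<and> norm (h w) \<le> C / \<bar>w\<bar>"
    using chord_and_H_integrand_bounds[OF sm speed, of x] unfolding \<rho>_def h_def by metis
  note cut = principal_value_cutoffs[OF Jbor \<rho>meas \<rho>le
      embedded_curve_separation[OF assms(1,2), of _ x, folded J_def \<rho>_def] KCr near]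
  have scale: "((\<lambda>\<epsilon>. 2 *\<^sub>R f \<epsilon>) \<longlongrightarrow> 0) (at_right 0) \<longleftrightarrow> (f \<longlongrightarrow> 0) (at_right 0)"
    for f :: "real \<Rightarrow> real ^ 'n"
    using tendsto_scaleR[OF tendsto_const, of f 0 "at_right 0" 2]
      tendsto_scaleR[OF tendsto_const, of "\<lambda>\<epsilon>. 2 *\<^sub>R f \<epsilon>" 0 "at_right 0" "1/2"] by auto
  show "has_H I \<gamma> x 0 \<longleftrightarrow>
      (\<forall>\<epsilon>>0. set_integrable hausdorff1 (range \<gamma> - ball (\<gamma> x) \<epsilon>)
         (\<lambda>y. (1 / (norm (\<gamma> x - y))\<^sup>2) *\<^sub>R (circle_curvature \<gamma> x y - curvature_vector \<gamma> x))) \<and>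
      ((\<lambda>\<epsilon>. LINT y:(range \<gamma> - ball (\<gamma> x) \<epsilon>)|hausdorff1.
         (1 / (norm (\<gamma> x - y))\<^sup>2) *\<^sub>R (circle_curvature \<gamma> x y - curvature_vector \<gamma> x))
        \<longlongrightarrow> 0) (at_right 0)"
    unfolding has_H_def F_def[symmetric] transfer scale
    unfolding h_def[symmetric] J_def[symmetric]
    using cut(1) tendsto_zero_iff_of_diff[OF cut(2)] by blast
qed

end
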